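(* Let $N\ge1$ be an integer, let $q\ge\frac{3}{2N+2}$, and let $f,g\in\mathcal{S}(2q)$ with frequency sets $Y^f,Y^g$ and coefficients $(c^f_y)_{y\in Y^f}$, $(c^g_y)_{y\in Y^g}$. Assume that all coefficients of $f$ and $g$ have modulus at least $c_{\min}\in\mathbb{R}_{>0}$. If $$\sum_{k=-N}^N|f(k)-g(k)|^2<\frac{4N+4}{3}c_{\min}^2,$$ then for every $y\in Y^f$ there is exactly one $n(y)\in Y^g$ with $|y-n(y)|_{\mathbb{T}}<\frac{3}{2N+2}$. Furthermore, the following estimate holds: $$\sum_{y\in Y^f}\left[\frac{N+1}{3}\left|c^f_y-c^g_{n(y)}\right|^2+\frac{2\pi^2(N+1)^3}{3^5}\,|y-n(y)|_{\mathbb{T}}^2\,\left|c^f_y+c^g_{n(y)}\right|^2\right]\ \le\ \sum_{k=-N}^N|f(k)-g(k)|^2 .$$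
   Context: An exponential sum is a function $f:\mathbb{R}\to\mathbb{C}$ of the form $f(x)=\sum_{y\in Y}c_y e^{2\pi i yx}$ with $Y\subset[0,1)$ finite and $c_y\in\mathbb{C}\setminus\{0\}$. The set of all of these is $\mathcal{S}$. For $f\in\mathcal{S}$, $Y^f=Y$ is its set of frequencies and $c^f=(c^f_y)_{y\in Y^f}$ its coefficient vector. The wrap-around distance is $|y-y'|_{\mathbb{T}}=\min_{k\in\mathbb{Z}}|y-y'-k|$. For a finite $Y\subset[0,1)$, $\operatorname{sep}Y=\min_{y\ne y'\in Y}|y-y'|_{\mathbb{T}}$ (a condition $\operatorname{sep}Y\ge r$ is vacuously satisfied if $Y$ has at most one element), and for $r>0$, $\mathcal{S}(r)=\{f\in\mathcal{S}:\operatorname{sep}Y^f\ge r\}$. *)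

theory Defs
  imports "HOL-Analysis.Analysis" "HOL-Computational_Algebra.Polynomial"
begin

definition exp_sum_rep :: "(real \<Rightarrow> complex) \<Rightarrow> real set \<Rightarrow> (real \<Rightarrow> complex) \<Rightarrow> bool" where
  "exp_sum_rep f Y c \<longleftrightarrow>
     finite Y \<and> Y \<subseteq> {0..<1} \<and> (\<forall>y\<in>Y. c y \<noteq> 0) \<and>
     (\<forall>x. f x = (\<Sum>y\<in>Y. c y * exp (2 * of_real pi * \<i> * of_real (y * x))))"

definition exp_sums :: "(real \<Rightarrow> complex) set" where
  "exp_sums = {f. \<exists>Y c. exp_sum_rep f Y c}"

text \<open>Frequencies and coefficients are attached to the function itself. The descriptions below
  are well defined on exponential sums, see \<open>exp_sum_rep_unique\<close>; the coefficient
  vector is extended by zero off the frequency set to make it a unique total function.\<close>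

definition freqs :: "(real \<Rightarrow> complex) \<Rightarrow> real set" where
  "freqs f = (THE Y. \<exists>c. exp_sum_rep f Y c)"

definition coeffs_of :: "(real \<Rightarrow> complex) \<Rightarrow> real \<Rightarrow> complex" where
  "coeffs_of f = (THE c. exp_sum_rep f (freqs f) c \<and> (\<forall>y. y \<notin> freqs f \<longrightarrow> c y = 0))"

text \<open>The infimum is attained, see \<open>wrap_dist_attained\<close>.\<close>

definition wrap_dist :: "real \<Rightarrow> real \<Rightarrow> real" where
  "wrap_dist y y' = (INF k::int. \<bar>y - y' - of_int k\<bar>)"

text \<open>For finite \<open>Y\<close> this is a minimum; if \<open>Y\<close> has at most one element, it is \<open>\<infinity>\<close>,
  so that every lower bound on \<open>sep Y\<close> holds vacuously.\<close>

definition sep :: "real set \<Rightarrow> ereal" where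
  "sep Y = (INF (y, y') \<in> {(y, y'). y \<in> Y \<and> y' \<in> Y \<and> y \<noteq> y'}. ereal (wrap_dist y y'))"

definition exp_sums_sep :: "real \<Rightarrow> (real \<Rightarrow> complex) set" where
  "exp_sums_sep r = {f \<in> exp_sums. sep (freqs f) \<ge> ereal r}"

lemma wrap_dist_attained: "\<exists>k::int. wrap_dist y y' = \<bar>y - y' - of_int k\<bar>"
proof -
  define t where "t = y - y'"
  define m :: int where "m = round t"
  have "\<bar>t - of_int m\<bar> \<le> \<bar>t - of_int k\<bar>" for k
    using round_diff_minimal[of t k] by (simp add: m_def)
  then have "(INF k::int. \<bar>t - of_int k\<bar>) = \<bar>t - of_int m\<bar>"
    by (intro cInf_eq_minimum) auto
  then show ?thesis
    unfolding wrap_dist_def t_def by blast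
qed

lemma sep_ge_iff:
  "sep Y \<ge> ereal r \<longleftrightarrow> (\<forall>y\<in>Y. \<forall>y'\<in>Y. y \<noteq> y' \<longrightarrow> wrap_dist y y' \<ge> r)"
  unfolding sep_def by (auto simp: le_INF_iff)

lemma exp_freq_inj:
  assumes "y \<in> {0..<1}" "y' \<in> {0..<1}"
    and "exp (2 * of_real pi * \<i> * of_real y) = exp (2 * of_real pi * \<i> * of_real y')"
  shows "y = (y'::real)"
proof -
  obtain n :: int where "2 * of_real pi * \<i> * of_real y
      = 2 * of_real pi * \<i> * of_real y' + (of_int (2 * n) * pi) * \<i>"
    using assms(3) unfolding exp_eq by blast
  then have "2 * pi * y = 2 * pi * y' + 2 * of_int n * pi"
    by (auto simp: complex_eq_iff)
  then have "2 * pi * y = 2 * pi * (y' + of_int n)" by (simp add: algebra_simps)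
  then have eq: "y = y' + of_int n" by simp
  then have "\<bar>of_int n :: real\<bar> < 1" using assms(1,2) by auto
  then have "n = 0" by linarith
  then show ?thesis using eq by simp
qed

lemma exp_sum_zero:
  assumes "finite Y" "Y \<subseteq> {0..<1}"
    and z: "\<And>x. (\<Sum>y\<in>Y. c y * exp (2 * of_real pi * \<i> * of_real (y * x))) = (0::complex)"
    and y: "y \<in> Y"
  shows "c y = 0"
proof -
  define e where "e = (\<lambda>y::real. exp (2 * of_real pi * \<i> * of_real y) :: complex)"
  have pow: "exp (2 * of_real pi * \<i> * of_real (w * real k)) = e w ^ k" for w k
    unfolding e_def by (simp add: exp_of_nat_mult[symmetric] algebra_simps)
  have zk: "(\<Sum>w\<in>Y. c w * e w ^ k) = 0" for k
    using z[of "real k"] unfolding pow .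
  define p where "p = (\<Prod>w\<in>Y - {y}. [:- e w, 1:])"
  have "(\<Sum>w\<in>Y. c w * poly p (e w)) = (\<Sum>w\<in>Y. \<Sum>i\<le>degree p. coeff p i * (c w * e w ^ i))"
    by (simp add: poly_altdef sum_distrib_left algebra_simps)
  also have "\<dots> = (\<Sum>i\<le>degree p. coeff p i * (\<Sum>w\<in>Y. c w * e w ^ i))"
    by (subst sum.swap) (simp add: sum_distrib_left)
  also have "\<dots> = 0" by (simp add: zk)
  finally have s: "(\<Sum>w\<in>Y. c w * poly p (e w)) = 0" .
  have "poly p (e w) = 0" if "w \<in> Y" "w \<noteq> y" for w
    using that assms(1) by (auto simp: p_def poly_prod)
  then have "(\<Sum>w\<in>Y. c w * poly p (e w)) = c y * poly p (e y)"
    using assms(1) y by (subst sum.remove[of _ y]) auto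
  moreover have "poly p (e y) \<noteq> 0"
  proof -
    have "e y \<noteq> e w" if "w \<in> Y - {y}" for w
      using exp_freq_inj[of y w] that y assms(2) unfolding e_def by blast
    then show ?thesis using assms(1) by (auto simp: p_def poly_prod)
  qed
  ultimately show ?thesis using s by simp
qed

lemma exp_sum_rep_unique:
  assumes "exp_sum_rep f Y c" "exp_sum_rep f Y' c'"
  shows "Y = Y'" and "\<And>y. y \<in> Y \<Longrightarrow> c y = c' y"
proof -
  define d where "d = (\<lambda>y. (if y \<in> Y then c y else 0) - (if y \<in> Y' then c' y else 0))"
  note r = assms[unfolded exp_sum_rep_def]
  have d0: "d y = 0" if "y \<in> Y \<union> Y'" for y
  proof (rule exp_sum_zero[OF _ _ _ that])
    show "finite (Y \<union> Y')" "Y \<union> Y' \<subseteq> {0..<1}" using r by auto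
    fix x :: real
    define E where "E = (\<lambda>y. exp (2 * of_real pi * \<i> * of_real (y * x)) :: complex)"
    have "(\<Sum>y\<in>Y \<union> Y'. d y * E y)
        = (\<Sum>y\<in>Y \<union> Y'. if y \<in> Y then c y * E y else 0) - (\<Sum>y\<in>Y \<union> Y'. if y \<in> Y' then c' y * E y else 0)"
      unfolding sum_subtractf[symmetric] by (intro sum.cong) (auto simp: d_def algebra_simps)
    also have "(\<Sum>y\<in>Y \<union> Y'. if y \<in> Y then c y * E y else 0) = (\<Sum>y\<in>Y. c y * E y)"
      using r by (intro sum.mono_neutral_cong_right) auto
    also have "(\<Sum>y\<in>Y \<union> Y'. if y \<in> Y' then c' y * E y else 0) = (\<Sum>y\<in>Y'. c' y * E y)"
      using r by (intro sum.mono_neutral_cong_right) auto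
    also have "(\<Sum>y\<in>Y. c y * E y) - (\<Sum>y\<in>Y'. c' y * E y) = 0"
      using r unfolding E_def by (metis right_minus_eq)
    finally show "(\<Sum>y\<in>Y \<union> Y'. d y * exp (2 * of_real pi * \<i> * of_real (y * x))) = 0"
      unfolding E_def .
  qed
  show YY: "Y = Y'"
  proof (intro set_eqI iffI)
    fix y assume "y \<in> Y"
    then show "y \<in> Y'" using d0[of y] r by (auto simp: d_def split: if_splits)
  next
    fix y assume "y \<in> Y'"
    then show "y \<in> Y" using d0[of y] r by (auto simp: d_def split: if_splits)
  qed
  show "c y = c' y" if "y \<in> Y" for y
    using d0[of y] that YY by (auto simp: d_def)
qed

lemma freqs_eq: "exp_sum_rep f Y c \<Longrightarrow> freqs f = Y"
  unfolding freqs_def using exp_sum_rep_unique(1) by (intro the_equality) blast+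

lemma coeffs_of_eq:
  assumes "exp_sum_rep f Y c"
  shows "coeffs_of f = (\<lambda>y. if y \<in> Y then c y else 0)"
proof -
  have fr: "freqs f = Y" by (rule freqs_eq[OF assms])
  have rep: "exp_sum_rep f Y (\<lambda>y. if y \<in> Y then c y else 0)"
    using assms by (auto simp: exp_sum_rep_def)
  show ?thesis
    unfolding coeffs_of_def fr
  proof (rule the_equality)
    fix c' assume "exp_sum_rep f Y c' \<and> (\<forall>y. y \<notin> Y \<longrightarrow> c' y = 0)"
    then show "c' = (\<lambda>y. if y \<in> Y then c y else 0)"
      using exp_sum_rep_unique(2)[OF assms, of Y c'] by fastforce
  qed (use rep in auto)
qed

end

theory Submission
  imports Defs
begin

text \<open>Let M = N + 1. The energy of an exponential sum h with coefficients d and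
  frequencies x on the integers of [-N, N] is bounded from below by means of a weight w on the
  integers that is at most 1 everywhere and nonpositive outside [-N, N]: it is at least the sum
  of w k |h(k)|^2 over all integers k. If w k are the Fourier coefficients of a function W, that
  sum equals the quadratic form in d with entries W(x_i - x_j)
  (\<open>minorant_energy_le\<close>, proved via Fejer means). The point is to find a weight
  whose function W vanishes at distance 3/(2M) and beyond. Then, for h = f - g, frequencies
  interact only if one belongs to f, the other to g, and they are closer than 3/(2M). Because
  the frequencies of each function are separated by 3/M, each frequency has at most one such
  partner, and the form decouples into single frequencies and pairs
  (\<open>matched_energy_le\<close>).

  A single frequency with coefficient c contributes W(0) |c|^2. A pair with coefficients a and
  -b at distance r contributes W(0) (|a|^2 + |b|^2) - 2 W(r) Re (a cnj b), which is (W(0) +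
  W(r))/2 |a - b|^2 + (W(0) - W(r))/2 |a + b|^2. So the theorem follows from three properties of
  W: W(0) >= 4M/3, which forbids unmatched frequencies of f under the assumption on the energy,
  and two lower bounds for the coefficients of a pair.

  The bound W(0) >= 4M/3 leaves no room: 2M - 2M/3 is the largest integral of a minorant of the
  indicator function of [-M, M] with this Fourier support. So W comes from Selberg's extremal
  construction. Up to scaling it is the explicit function \<open>profile\<close>, whose cosine
  transform \<open>weight\<close> is a squared cosine times a rational function. That the
  transform is nonpositive where it has to be (\<open>weight_nonpos\<close>) is algebra; that it
  is at most 1 (\<open>weight_le_one\<close>) follows from a comparison of 1/sin^2 with finitely
  many of its poles (\<open>four_poles_le\<close>). The bounds for pairs are far from sharp and
  follow from Taylor estimates of the profile. For N = 1 the support of W would not fit on the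
  circle; there the Dirichlet kernel does the job.\<close>

section \<open>The distance on the circle\<close>

lemma wrap_dist_le: "wrap_dist y y' \<le> \<bar>y - y' - of_int k\<bar>"
  unfolding wrap_dist_def by (rule cINF_lower) (auto intro!: bdd_belowI[of _ 0])

lemma wrap_dist_nonneg: "wrap_dist y y' \<ge> 0"
  using wrap_dist_attained[of y y'] by fastforce

lemma wrap_dist_diff: "wrap_dist (y - y') 0 = wrap_dist y y'"
  by (simp add: wrap_dist_def)

lemma wrap_dist_triangle: "wrap_dist x z \<le> wrap_dist x y + wrap_dist y z"
proof -
  obtain k l where "wrap_dist x y = \<bar>x - y - of_int k\<bar>" "wrap_dist y z = \<bar>y - z - of_int l\<bar>"
    using wrap_dist_attained by metis
  then show ?thesis using wrap_dist_le[of x z "k + l"] by simp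
qed

lemma wrap_dist_commute: "wrap_dist x y = wrap_dist y x"
proof -
  have "wrap_dist x y \<le> wrap_dist y x" for x y
  proof -
    obtain k where "wrap_dist y x = \<bar>y - x - of_int k\<bar>"
      using wrap_dist_attained by blast
    then show ?thesis using wrap_dist_le[of x y "-k"] by simp
  qed
  then show ?thesis by (simp add: antisym)
qed

lemma wrap_dist_le_half: "wrap_dist x y \<le> 1 / 2"
  using wrap_dist_le[of x y "round (x - y)"] of_int_round_abs_le[of "x - y"] by linarith

lemma wrap_dist_small:
  assumes "\<bar>x\<bar> \<le> 1 / 2"
  shows "wrap_dist x 0 = \<bar>x\<bar>"
proof -
  obtain k where k: "wrap_dist x 0 = \<bar>x - of_int k\<bar>"
    using wrap_dist_attained[of x 0] by auto
  have "\<bar>x - of_int k\<bar> \<ge> \<bar>x\<bar>"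
  proof (cases "k = 0")
    case False
    then have "\<bar>real_of_int k\<bar> \<ge> 1" by linarith
    then show ?thesis using assms by linarith
  qed simp
  then show ?thesis using k wrap_dist_le[of x 0 0] by simp
qed

lemma wrap_dist_perturb: "\<bar>wrap_dist x 0 - wrap_dist y 0\<bar> \<le> wrap_dist x y"
  using wrap_dist_triangle[of x 0 y] wrap_dist_triangle[of y 0 x] wrap_dist_commute[of x y] by linarith

lemma pi_squared_less_10: "pi\<^sup>2 < 10"
proof -
  have "pi * pi < 3.15 * 3.15" using pi_approx by (intro mult_strict_mono) auto
  then show ?thesis by (simp add: power2_eq_square)
qed

lemma le_sin_pi_times:
  assumes "0 \<le> r" "r \<le> 1 / 2"
  shows "r \<le> sin (pi * r)"
proof -
  define y where "y = pi * r"
  have y: "0 \<le> y" "y \<le> pi / 2" using assms by (auto simp: y_def)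
  have "y\<^sup>2 \<le> (pi / 2)\<^sup>2" using y by (intro power_mono)
  then have y2: "y\<^sup>2 \<le> 5 / 2" using pi_squared_less_10 by (simp add: power_divide)
  have "\<bar>sin y - y\<bar> \<le> y * y\<^sup>2 / 6"
    using Maclaurin_sin_bound[of y 3] y
    by (simp add: eval_nat_numeral sin_coeff_def fact_numeral field_simps)
  also have "\<dots> \<le> y * (5 / 2) / 6"
    using y y2 by (intro divide_right_mono mult_left_mono) auto
  finally have "sin y \<ge> y / 2" using y by linarith
  moreover have "y \<ge> 3 * r" unfolding y_def using assms pi_gt3 by (intro mult_right_mono) auto
  ultimately show ?thesis using assms unfolding y_def by linarith
qed

text \<open>The chord between two points of the unit circle is comparable to the arc between
  them. This is what makes the Fejer kernel small away from the integers.\<close>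

lemma norm_one_minus_cis_ge: "norm (1 - cis (2 * pi * t)) \<ge> 2 * wrap_dist t 0"
proof -
  obtain k where k: "wrap_dist t 0 = \<bar>t - of_int k\<bar>"
    using wrap_dist_attained[of t 0] by auto
  define r where "r = \<bar>t - of_int k\<bar>"
  have r: "0 \<le> r" "r \<le> 1 / 2" using wrap_dist_le_half[of t 0] k by (auto simp: r_def)
  have "cos (2 * pi * t) = cos (2 * pi * (t - of_int k))"
    using cos.plus_of_int[of "2 * pi * (t - of_int k)" k] by (simp add: algebra_simps)
  also have "\<dots> = cos (2 * (pi * r))"
    unfolding r_def by (cases "t - of_int k \<ge> 0")  (auto simp: abs_if algebra_simps cos_diff)
  finally have c: "cos (2 * pi * t) = 1 - 2 * (sin (pi * r))\<^sup>2" by (simp add: cos_double_sin)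
  have "(norm (1 - cis (2 * pi * t)))\<^sup>2 = (1 - cos (2 * pi * t))\<^sup>2 + (sin (2 * pi * t))\<^sup>2"
    by (simp add: cmod_power2)
  also have "\<dots> = 2 - 2 * cos (2 * pi * t)"
    using sin_cos_squared_add[of "2 * pi * t"] by (simp add: power2_eq_square algebra_simps)
  also have "\<dots> = (2 * sin (pi * r))\<^sup>2" using c by (simp add: power2_eq_square)
  finally have e: "(norm (1 - cis (2 * pi * t)))\<^sup>2 = (2 * sin (pi * r))\<^sup>2" .
  have "r \<le> sin (pi * r)"
    using le_sin_pi_times r by simp
  then have "(2 * r)\<^sup>2 \<le> (2 * sin (pi * r))\<^sup>2" using r by (intro power_mono) auto
  then show ?thesis using e k unfolding r_def[symmetric] by (metis norm_ge_zero power2_le_imp_le)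
qed

section \<open>The profile\<close>

text \<open>On [0,1] this is the Fourier transform of a minorant for an interval of Selberg's
  extremal type. With s = u + 3/2, that minorant is (sin (pi s) / pi)^2 (1/(s-1)^2 + 1/(s-2)^2 +
  a (1/s - 1/(s-3))), which at the nodes 0, 1, 2, 3 takes the values 0, 1, 1, 0. Any a in [2/3,
  1] gives a minorant of the indicator function of [-3/2, 3/2]; the value a = 2/3 is chosen here
  because the profile is then flat at 0, so that its even extension is differentiable
  there.\<close>

definition profile :: "real \<Rightarrow> real" where
  "profile s = 2 * (1 - s) * cos (pi * s) + 2 / (3 * pi) * sin (3 * pi * s)"

lemma two_over_three_pi_less: "2 / (3 * pi) < 2 / 9"
  using pi_gt3 by (simp add: field_simps)

text \<open>From s = 1/2 on, where the cosine is nonpositive, the product (1 - s) cos (pi s) is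
  at least -1/4: the cosine is at least -4 (s - 1/2), and the parabola 4 (1 - s) (s - 1/2) has
  its maximum 1/4 at 3/4.\<close>

lemma profile_ge:
  assumes "0 \<le> s" "s \<le> 1"
  shows "profile s \<ge> -1"
proof -
  have c: "2 / (3 * pi) * sin (3 * pi * s) \<ge> - (2 / 9)"
  proof -
    have "2 / (3 * pi) * (- sin (3 * pi * s)) \<le> 2 / (3 * pi) * 1"
      by (intro mult_left_mono) (use sin_ge_minus_one[of "3 * pi * s"] in linarith, simp)
    then show ?thesis using two_over_three_pi_less by linarith
  qed
  have "(1 - s) * cos (pi * s) \<ge> - (1 / 4)"
  proof (cases "s \<le> 1 / 2")
    case True
    then have "cos (pi * s) \<ge> 0" using assms
      by (intro cos_ge_zero) (auto simp: mult.commute[of pi] intro: order_trans[of _ 0])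
    then have "(1 - s) * cos (pi * s) \<ge> 0" using assms by simp
    then show ?thesis by linarith
  next
    case False
    have "- cos (pi * s) = sin (pi * (s - 1 / 2))"
      by (simp add: sin_diff right_diff_distrib)
    also have "\<dots> \<le> pi * (s - 1 / 2)" using False by (intro sin_x_le_x) auto
    also have "\<dots> \<le> 4 * (s - 1 / 2)" using False pi_less_4 by (intro mult_right_mono) auto
    finally have "(1 - s) * (- cos (pi * s)) \<le> (1 - s) * (4 * (s - 1 / 2))"
      using assms by (intro mult_left_mono) auto
    also have "\<dots> = 1 / 4 - 4 * (s - 3 / 4)\<^sup>2" by (simp add: power2_eq_square algebra_simps)
    also have "\<dots> \<le> 1 / 4" by simp
    finally show ?thesis by simp
  qed
  then show ?thesis using c unfolding profile_def mult.assoc[of 2 "1 - s"] by linarith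
qed

lemma cos_le_quartic: "cos x \<le> 1 - x\<^sup>2 / 2 + x ^ 4 / (24::real)"
proof -
  obtain t where "cos x = (\<Sum>m<4. cos_coeff m * x ^ m) + (cos (t + 1 / 2 * real (4::nat) * pi) / fact 4) * x ^ 4"
    using Maclaurin_cos_expansion[of x 4] by auto
  moreover have "cos (t + 2 * pi) / 24 * x ^ 4 \<le> 1 / 24 * x ^ 4"
    by (intro mult_right_mono divide_right_mono) auto
  moreover have "(\<Sum>m<4. cos_coeff m * x ^ m) = 1 - x\<^sup>2 / 2"
    by (simp add: lessThan_nat_numeral lessThan_Suc cos_coeff_def fact_numeral)
  ultimately show ?thesis by (simp add: fact_numeral)
qed

text \<open>Near 0 the linear terms of the two summands cancel, and 2 - profile s is close to
  pi^2 s^2; so there is ample room. Up to 1/2 the quartic Taylor bound for the cosine suffices,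
  beyond 1/2 the first summand is nonpositive and the second is below 2/9.\<close>

lemma profile_le:
  assumes "0 \<le> s" "s \<le> 1"
  shows "pi\<^sup>2 * s\<^sup>2 / 18 \<le> 2 - profile s"
proof -
  note pi2 = pi_squared_less_10
  show ?thesis
  proof (cases "s \<le> 1 / 2")
    case True
    define p where "p = pi\<^sup>2 * s\<^sup>2"
    have "2 / (3 * pi) * sin (3 * pi * s) \<le> 2 / (3 * pi) * (3 * pi * s)"
      using assms by (intro mult_left_mono sin_x_le_x) auto
    then have a: "2 / (3 * pi) * sin (3 * pi * s) \<le> 2 * s" by simp
    have "cos (pi * s) \<le> 1 - p / 2 + p\<^sup>2 / 24"
      using cos_le_quartic[of "pi * s"] by (simp add: p_def power_mult_distrib flip: power_mult)
    also have "\<dots> \<le> 1 - 3 / 8 * p"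
    proof -
      have "s\<^sup>2 \<le> (1 / 2)\<^sup>2" using True assms by (intro power_mono)
      then have "p \<le> 10 * (1 / 4)" unfolding p_def using pi2
        by (intro mult_mono) (auto simp: power2_eq_square)
      then have "p * (p - 3) \<le> 0" by (intro mult_nonneg_nonpos) (auto simp: p_def)
      then show ?thesis by (simp add: power2_eq_square algebra_simps)
    qed
    finally have "2 * (1 - s) * cos (pi * s) \<le> 2 * (1 - s) * (1 - 3 / 8 * p)"
      using assms by (intro mult_left_mono) auto
    also have "\<dots> = 2 - 2 * s - (1 - s) * (3 / 4 * p)" by (simp add: field_simps)
    finally have "2 - profile s \<ge> (1 - s) * (3 / 4 * p)"
      using a unfolding profile_def by linarith
    moreover have "(1 - s) * (3 / 4 * p) \<ge> 1 / 2 * (3 / 4 * p)"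
      using True by (intro mult_right_mono) (auto simp: p_def)
    moreover have "p \<ge> 0" by (simp add: p_def)
    ultimately show ?thesis unfolding p_def[symmetric] by linarith
  next
    case False
    have "cos (pi * s) \<le> 0"
    proof -
      have "cos (pi * s) \<le> cos (pi / 2)"
        using False assms by (intro cos_monotone_0_pi_le) auto
      then show ?thesis by simp
    qed
    then have "2 * (1 - s) * cos (pi * s) \<le> 0" using assms by (intro mult_nonneg_nonpos) auto
    moreover have "2 / (3 * pi) * sin (3 * pi * s) \<le> 2 / (3 * pi) * 1"
      by (intro mult_left_mono) auto
    moreover have "pi\<^sup>2 * s\<^sup>2 \<le> 10 * 1"
      using assms pi2 by (intro mult_mono) (auto simp: power_le_one)
    ultimately show ?thesis using two_over_three_pi_less unfolding profile_def by linarith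
  qed
qed

section \<open>Trigonometric bounds from poles\<close>

lemma cos_ge_sextic: "cos x \<ge> 1 - x\<^sup>2 / 2 + x ^ 4 / 24 - x ^ 6 / (720::real)"
proof -
  obtain t where "cos x = (\<Sum>m<6. cos_coeff m * x ^ m) + (cos (t + 1 / 2 * real (6::nat) * pi) / fact 6) * x ^ 6"
    using Maclaurin_cos_expansion[of x 6] by auto
  moreover have "cos (t + 3 * pi) / 720 * x ^ 6 \<ge> (-1) / 720 * x ^ 6"
    by (intro mult_right_mono divide_right_mono) auto
  moreover have "(\<Sum>m<6. cos_coeff m * x ^ m) = 1 - x\<^sup>2 / 2 + x ^ 4 / 24"
    by (simp add: lessThan_nat_numeral lessThan_Suc cos_coeff_def fact_numeral)
  ultimately show ?thesis by (simp add: fact_numeral)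
qed

text \<open>For nonzero sin y this is 1/sin^2 y >= 1/y^2 + 1/3, the beginning of the Laurent
  expansion. If y^2 >= 3/2 the trivial bound of the sine by 1 is enough; below that a Taylor
  bound applies.\<close>

lemma sin_squared_le:
  fixes y :: real
  shows "(3 + y\<^sup>2) * (sin y)\<^sup>2 \<le> 3 * y\<^sup>2"
proof (cases "y\<^sup>2 \<le> 3 / 2")
  case True
  define p where "p = y\<^sup>2"
  have "(sin y)\<^sup>2 = (1 - cos (2 * y)) / 2" by (simp add: cos_double_sin)
  also have "\<dots> \<le> p - p\<^sup>2 / 3 + 2 * p ^ 3 / 45"
    using cos_ge_sextic[of "2 * y"] by (simp add: p_def power_mult_distrib flip: power_mult)
  finally have "(3 + p) * (sin y)\<^sup>2 \<le> (3 + p) * (p - p\<^sup>2 / 3 + 2 * p ^ 3 / 45)"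
    by (intro mult_left_mono) (auto simp: p_def)
  also have "\<dots> = 3 * p - p ^ 3 * (1 / 5 - 2 * p / 45)"
    by (simp add: eval_nat_numeral field_simps)
  also have "\<dots> \<le> 3 * p" using True by (simp add: p_def)
  finally show ?thesis by (simp add: p_def)
next
  case False
  have "(3 + y\<^sup>2) * (sin y)\<^sup>2 \<le> (3 + y\<^sup>2) * 1"
    by (intro mult_left_mono) (auto simp: sin_squared_eq)
  also have "\<dots> \<le> 3 * y\<^sup>2" using False by simp
  finally show ?thesis .
qed

text \<open>The numbers 1/sin^2 (pi v) dominate the sum of 1/(v - n)^2 over any set of integers
  n. Only the pole at 0 and one neighbouring pole are kept. They are separated by 4/sin^2 (2x) =
  1/sin^2 x + 1/cos^2 x, with the cosine read as a sine centred at the second pole, so that the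
  Laurent bound applies to both summands. The two constants 1/3 that it yields survive as the
  term pi^2/6.\<close>

lemma sin_squared_two_poles:
  assumes "v \<noteq> 0" "w \<noteq> 0" "(sin (pi * w / 2))\<^sup>2 = (cos (pi * v / 2))\<^sup>2"
  shows "(sin (pi * v))\<^sup>2 * (1 / v\<^sup>2 + 1 / w\<^sup>2 + pi\<^sup>2 / 6) \<le> pi\<^sup>2"
proof -
  define p where "p = (sin (pi * v / 2))\<^sup>2"
  define r where "r = (cos (pi * v / 2))\<^sup>2"
  have pr: "p + r = 1" "0 \<le> p" "0 \<le> r" by (auto simp: p_def r_def)
  have one: "(sin (pi * t / 2))\<^sup>2 * (4 / t\<^sup>2 + pi\<^sup>2 / 3) \<le> pi\<^sup>2" if "t \<noteq> 0" for t
  proof -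
    have "(sin (pi * t / 2))\<^sup>2 * (4 / t\<^sup>2 + pi\<^sup>2 / 3)
        = 4 / (3 * t\<^sup>2) * ((3 + (pi * t / 2)\<^sup>2) * (sin (pi * t / 2))\<^sup>2)"
      using that by (simp add: field_simps power2_eq_square)
    also have "\<dots> \<le> 4 / (3 * t\<^sup>2) * (3 * (pi * t / 2)\<^sup>2)"
      by (intro mult_left_mono sin_squared_le) auto
    also have "\<dots> = pi\<^sup>2" using that by (simp add: field_simps power2_eq_square)
    finally show ?thesis .
  qed
  have "p * r * (4 / v\<^sup>2 + pi\<^sup>2 / 3) \<le> r * pi\<^sup>2"
    using mult_left_mono[OF one[OF assms(1)] pr(3)] by (simp add: p_def algebra_simps)
  moreover have "p * r * (4 / w\<^sup>2 + pi\<^sup>2 / 3) \<le> p * pi\<^sup>2"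
    using mult_left_mono[OF one[OF assms(2)] pr(2)] by (simp add: assms(3) r_def algebra_simps)
  ultimately have "p * r * (4 / v\<^sup>2 + pi\<^sup>2 / 3) + p * r * (4 / w\<^sup>2 + pi\<^sup>2 / 3) \<le> (p + r) * pi\<^sup>2"
    by (simp add: algebra_simps)
  then have "4 * p * r * (1 / v\<^sup>2 + 1 / w\<^sup>2 + pi\<^sup>2 / 6) \<le> pi\<^sup>2"
    by (simp add: pr algebra_simps)
  moreover have "(sin (pi * v))\<^sup>2 = 4 * p * r"
    using sin_double[of "pi * v / 2"] by (simp add: p_def r_def power_mult_distrib)
  ultimately show ?thesis by simp
qed

text \<open>In the variable v the nodes of the minorant are -2, -1, 0, 1. The simple poles at -2
  and 1 have to be paid for. Up to v = 1/2 the constant pi^2/6 left over from the double poles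
  at 0 and -1 covers them. Closer to 1 the full double pole at 1 is used instead, which exceeds
  the simple poles and the bounded contribution of -1 together.\<close>

lemma four_poles_le:
  assumes "- 1 / 2 \<le> v" "v < 1" "v \<noteq> 0"
  shows "(sin (pi * v))\<^sup>2 * (1 / v\<^sup>2 + 1 / (1 + v)\<^sup>2 + 2 / ((1 - v) * (2 + v))) \<le> pi\<^sup>2"
proof (cases "v \<le> 1 / 2")
  case True
  have "pi * (1 + v) / 2 = pi * v / 2 + pi / 2" by (simp add: field_simps)
  then have "sin (pi * (1 + v) / 2) = cos (pi * v / 2)" by (simp only: sin_add) simp
  then have two: "(sin (pi * v))\<^sup>2 * (1 / v\<^sup>2 + 1 / (1 + v)\<^sup>2 + pi\<^sup>2 / 6) \<le> pi\<^sup>2"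
    using assms by (intro sin_squared_two_poles) auto
  have "(1 / 2 - v) * (v + 3 / 2) \<ge> 0" using assms True by (intro mult_nonneg_nonneg) auto
  (* the product decreases from 9/4 to 5/4 on this range, and 2 / (5/4) = 1.6 < pi^2/6 *)
  then have "(1 - v) * (2 + v) \<ge> 5 / 4" by (simp add: field_simps)
  then have "2 / ((1 - v) * (2 + v)) \<le> 2 / (5 / 4)" by (intro divide_left_mono) auto
  also have "\<dots> \<le> pi\<^sup>2 / 6"
  proof -
    have "3.14 * 3.14 \<le> pi * pi" using pi_approx by (intro mult_mono) auto
    then show ?thesis by (simp add: power2_eq_square)
  qed
  finally have "(sin (pi * v))\<^sup>2 * (1 / v\<^sup>2 + 1 / (1 + v)\<^sup>2 + 2 / ((1 - v) * (2 + v)))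
      \<le> (sin (pi * v))\<^sup>2 * (1 / v\<^sup>2 + 1 / (1 + v)\<^sup>2 + pi\<^sup>2 / 6)"
    by (intro mult_left_mono) auto
  then show ?thesis using two by linarith
next
  case False
  have "pi * (1 - v) / 2 = pi / 2 - pi * v / 2" by (simp add: field_simps)
  then have "sin (pi * (1 - v) / 2) = cos (pi * v / 2)" by (simp only: sin_diff) simp
  then have two: "(sin (pi * v))\<^sup>2 * (1 / v\<^sup>2 + 1 / (1 - v)\<^sup>2 + pi\<^sup>2 / 6) \<le> pi\<^sup>2"
    using assms by (intro sin_squared_two_poles) auto
  define p where "p = 1 / (1 - v)"
  have p: "p \<ge> 2" unfolding p_def using False assms by (simp add: field_simps)
  have a: "2 / ((1 - v) * (2 + v)) \<le> p"
  proof -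
    have "2 / ((1 - v) * (2 + v)) \<le> 2 / ((1 - v) * 2)"
      using False assms by (intro divide_left_mono mult_left_mono) auto
    moreover have "2 / ((1 - v) * 2) = p" using assms by (simp add: p_def field_simps)
    ultimately show ?thesis by linarith
  qed
  have "1 \<le> (1 + v)\<^sup>2" using False by (intro one_le_power) auto
  then have "1 / (1 + v)\<^sup>2 \<le> 1" by (subst divide_le_eq_1) linarith
  moreover have "p\<^sup>2 \<ge> 2 * p" using p by (simp add: power2_eq_square)
  moreover have "pi\<^sup>2 / 6 \<ge> 0" by simp
  ultimately have "1 / (1 + v)\<^sup>2 + 2 / ((1 - v) * (2 + v)) \<le> 1 / (1 - v)\<^sup>2 + pi\<^sup>2 / 6"
    using a p unfolding p_def power_divide by (simp only: one_power2)
  then have "(sin (pi * v))\<^sup>2 * (1 / v\<^sup>2 + 1 / (1 + v)\<^sup>2 + 2 / ((1 - v) * (2 + v)))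
      \<le> (sin (pi * v))\<^sup>2 * (1 / v\<^sup>2 + 1 / (1 - v)\<^sup>2 + pi\<^sup>2 / 6)"
    by (intro mult_left_mono) auto
  then show ?thesis using two by linarith
qed

section \<open>The cosine transform of the profile\<close>

text \<open>The cosine transform of the triangle 1 - s on [0,1], with the removable singularity
  at 0 filled.\<close>

definition tri_cos :: "real \<Rightarrow> real" where
  "tri_cos b = (if b = 0 then 1 / 2 else (1 - cos b) / b\<^sup>2)"

lemma has_integral_tri_cos: "((\<lambda>s. (1 - s) * cos (b * s)) has_integral tri_cos b) {0..1}"
proof (cases "b = 0")
  case True
  have "((\<lambda>s::real. 1 - s) has_integral ((1 - 1\<^sup>2 / 2) - (0 - 0\<^sup>2 / 2))) {0..1}"
    by (rule fundamental_theorem_of_calculus)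
       (auto intro!: derivative_eq_intros simp flip: has_real_derivative_iff_has_vector_derivative)
  then show ?thesis using True by (simp add: tri_cos_def)
next
  case False
  define F where "F = (\<lambda>s. (1 - s) * sin (b * s) / b - cos (b * s) / b\<^sup>2)"
  have "((\<lambda>s. (1 - s) * cos (b * s)) has_integral (F 1 - F 0)) {0..1}"
    unfolding F_def using False
    by (intro fundamental_theorem_of_calculus)
       (auto intro!: derivative_eq_intros simp: field_simps power2_eq_square
             simp flip: has_real_derivative_iff_has_vector_derivative)
  then show ?thesis using False by (simp add: tri_cos_def F_def diff_divide_distrib)
qed

lemma has_integral_sin:
  fixes b :: real
  shows "((\<lambda>s. sin (b * s)) has_integral ((1 - cos b) / b)) {0..1}"
proof (cases "b = 0")
  case False
  define F where "F = (\<lambda>s. - cos (b * s) / b)"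
  have "((\<lambda>s. sin (b * s)) has_integral (F 1 - F 0)) {0..1}"
    using False
    by (intro fundamental_theorem_of_calculus)
       (auto intro!: derivative_eq_intros simp: F_def
             simp flip: has_real_derivative_iff_has_vector_derivative)
  then show ?thesis by (simp add: F_def diff_divide_distrib)
qed simp

text \<open>The cosine transform of the profile. In the second summand the convention x / 0 = 0
  gives the right value at the zeros of the denominators, since the integral of sin (0 s) is
  0.\<close>

definition weight :: "real \<Rightarrow> real" where
  "weight u = 2 * tri_cos (2 * pi * u + pi) + 2 * tri_cos (2 * pi * u - pi)
     + 2 / (3 * pi) * ((1 - cos (3 * pi + 2 * pi * u)) / (3 * pi + 2 * pi * u)
                     + (1 - cos (3 * pi - 2 * pi * u)) / (3 * pi - 2 * pi * u))"

lemma has_integral_weight: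
  "((\<lambda>s. 2 * (profile s * cos (2 * pi * u * s))) has_integral weight u) {0..1}"
proof -
  have "2 * (profile s * cos (2 * pi * u * s))
      = 2 * ((1 - s) * cos ((2 * pi * u + pi) * s)) + 2 * ((1 - s) * cos ((2 * pi * u - pi) * s))
        + 2 / (3 * pi) * (sin ((3 * pi + 2 * pi * u) * s) + sin ((3 * pi - 2 * pi * u) * s))" for s
    unfolding profile_def
    by (simp add: distrib_right left_diff_distrib sin_add sin_diff cos_add cos_diff)
       (simp add: field_simps)
  then show ?thesis unfolding weight_def
    by (simp only:) (intro has_integral_add has_integral_mult_right has_integral_tri_cos has_integral_sin)
qed

lemma cos_pm_pi:
  "cos (2 * pi * u + pi) = - cos (2 * pi * u)" "cos (2 * pi * u - pi) = - cos (2 * pi * u)"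
  "cos (3 * pi + 2 * pi * u) = - cos (2 * pi * u)" "cos (3 * pi - 2 * pi * u) = - cos (2 * pi * u)"
proof -
  have "3 * pi = pi + 2 * pi" by simp
  then have "cos (3 * pi) = -1" "sin (3 * pi) = 0" 
     by (metis cos_periodic cos_pi, metis sin_periodic sin_pi)
  then show "cos (3 * pi + 2 * pi * u) = - cos (2 * pi * u)" "cos (3 * pi - 2 * pi * u) = - cos (2 * pi * u)"
    by (simp_all add: cos_add cos_diff)
qed (simp_all add: cos_add cos_diff)

lemma weight_minus: "weight (- u) = weight u"
proof -
  have "tri_cos (- b) = tri_cos b" for b by (simp add: tri_cos_def)
  note even = this
  have e: "2 * pi * (- u) + pi = - (2 * pi * u - pi)" "2 * pi * (- u) - pi = - (2 * pi * u + pi)"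
    "3 * pi + 2 * pi * (- u) = 3 * pi - 2 * pi * u" "3 * pi - 2 * pi * (- u) = 3 * pi + 2 * pi * u"
    by simp_all
  show ?thesis unfolding weight_def e even by (simp only: add_ac)
qed

text \<open>All cosines in the definition of the weight are equal up to sign because the shifts
  are odd multiples of pi; factoring out 1 + cos (2 pi u) leaves a rational function. Its poles
  are the excluded points, where the factor vanishes.\<close>

lemma weight_eq:
  assumes "u \<noteq> 1 / 2" "u \<noteq> - 1 / 2" "u \<noteq> 3 / 2" "u \<noteq> - 3 / 2"
  shows "weight u = (1 + cos (2 * pi * u)) / pi\<^sup>2
    * (2 / (2 * u + 1)\<^sup>2 + 2 / (2 * u - 1)\<^sup>2 + 4 / ((3 + 2 * u) * (3 - 2 * u)))"
proof -
  have a: "2 * pi * u + pi = pi * (2 * u + 1)" "2 * pi * u - pi = pi * (2 * u - 1)"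
    "3 * pi + 2 * pi * u = pi * (3 + 2 * u)" "3 * pi - 2 * pi * u = pi * (3 - 2 * u)"
    by (simp_all add: algebra_simps)
  have nz: "2 * u + 1 \<noteq> 0" "2 * u - 1 \<noteq> 0" "3 + 2 * u \<noteq> 0" "3 - 2 * u \<noteq> 0" using assms by auto
  define C where "C = 1 + cos (2 * pi * u)"
  have t: "tri_cos (2 * pi * u + pi) = C / (pi\<^sup>2 * (2 * u + 1)\<^sup>2)"
    "tri_cos (2 * pi * u - pi) = C / (pi\<^sup>2 * (2 * u - 1)\<^sup>2)"
    unfolding tri_cos_def cos_pm_pi using nz
    by (auto simp: a power_mult_distrib C_def)
  have "2 / (3 * pi) * (C / (pi * (3 + 2 * u)) + C / (pi * (3 - 2 * u)))
     = C / pi\<^sup>2 * (4 / ((3 + 2 * u) * (3 - 2 * u)))"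
    using nz by (simp add: divide_simps power2_eq_square) (simp add: algebra_simps)
  then have "weight u = 2 * (C / (pi\<^sup>2 * (2 * u + 1)\<^sup>2)) + 2 * (C / (pi\<^sup>2 * (2 * u - 1)\<^sup>2))
      + C / pi\<^sup>2 * (4 / ((3 + 2 * u) * (3 - 2 * u)))"
    unfolding weight_def t cos_pm_pi by (simp only: a C_def[symmetric] diff_minus_eq_add)
  then show ?thesis
    unfolding C_def[symmetric] distrib_left by (simp add: mult.commute)
qed

lemma weight_half: "weight (1 / 2) = 1" "weight (3 / 2) = 0"
proof -
  have "3 * pi = pi + 2 * pi" "3 * pi - pi = 2 * pi"  "3 * pi + pi = 2 * (2 * pi)" by simp_all
  then have "cos (3 * pi) = -1" "cos (3 * pi - pi) = 1" "cos (3 * pi + pi) = 1"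
    by (metis cos_periodic cos_pi, metis cos_two_pi, metis cos_periodic cos_two_pi mult_2)
  then show "weight (1 / 2) = 1" "weight (3 / 2) = 0"
    using cos_pm_pi[of "3/2"]
    by (simp_all add: weight_def tri_cos_def)
qed

text \<open>With x = 4u^2 the rational factor is 4(x+1)/(x-1)^2 - 4/(x-9). Its sign is that of
  (x+1)(x-9) - (x-1)^2 = -6x - 10.\<close>

lemma weight_nonpos_aux:
  assumes "u \<ge> 3 / 2"
  shows "weight u \<le> 0"
proof (cases "u = 3 / 2")
  case False
  then have u: "u > 3 / 2" using assms by simp
  define x where "x = 4 * u\<^sup>2"
  have "2 * u * (2 * u) > 3 * 3" using u by (intro mult_strict_mono) auto
  then have x: "x > 9" by (simp add: x_def power2_eq_square)
  have ne: "2 * u + 1 \<noteq> 0" "2 * u - 1 \<noteq> 0" "3 + 2 * u \<noteq> 0" "3 - 2 * u \<noteq> 0" using u by auto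
  have "2 / (2 * u + 1)\<^sup>2 + 2 / (2 * u - 1)\<^sup>2 = 4 * (x + 1) / (x - 1)\<^sup>2"
  proof -
    have "(x - 1)\<^sup>2 = (2 * u + 1)\<^sup>2 * (2 * u - 1)\<^sup>2" 
      by (simp add: x_def power2_eq_square algebra_simps)
    then show ?thesis using ne
      by (simp add: divide_simps) (simp add: x_def power2_eq_square algebra_simps)
  qed
  also have "\<dots> \<le> 4 / (x - 9)"
  proof -
    have "(x + 1) * (x - 9) \<le> (x - 1)\<^sup>2" using x by (simp add: power2_eq_square algebra_simps)
    then show ?thesis using x by (simp add: field_simps)
  qed
  also have "\<dots> = - (4 / ((3 + 2 * u) * (3 - 2 * u)))"
  proof -
    have "(3 + 2 * u) * (3 - 2 * u) = - (x - 9)" by (simp add: x_def power2_eq_square algebra_simps)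
    then show ?thesis by (simp only: divide_minus_right minus_minus)
  qed
  finally have "2 / (2 * u + 1)\<^sup>2 + 2 / (2 * u - 1)\<^sup>2 + 4 / ((3 + 2 * u) * (3 - 2 * u)) \<le> 0" by simp
  moreover have "(1 + cos (2 * pi * u)) / pi\<^sup>2 \<ge> 0"
    using cos_ge_minus_one[of "2 * pi * u"] by (intro divide_nonneg_nonneg) (linarith, simp)
  ultimately have "(1 + cos (2 * pi * u)) / pi\<^sup>2
      * (2 / (2 * u + 1)\<^sup>2 + 2 / (2 * u - 1)\<^sup>2 + 4 / ((3 + 2 * u) * (3 - 2 * u))) \<le> 0"
    by (intro mult_nonneg_nonpos)
  then show ?thesis using u by (subst weight_eq) auto
next
  case True
  then show ?thesis unfolding True by (simp add: weight_half)
qed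

lemma weight_nonpos:
  assumes "\<bar>u\<bar> \<ge> 3 / 2"
  shows "weight u \<le> 0"
  using weight_nonpos_aux[of "\<bar>u\<bar>"] assms weight_minus[of u] by (auto simp: abs_if split: if_splits)

text \<open>Below 3/2 this is \<open>four_poles_le\<close> after the shift v = u - 1/2; from
  there on the weight is nonpositive.\<close>

lemma weight_le_one_aux:
  assumes "u \<ge> 0"
  shows "weight u \<le> 1"
proof (cases "u < 3 / 2 \<and> u \<noteq> 1 / 2")
  case True
  define v where "v = u - 1 / 2"
  have u: "u = v + 1 / 2" by (simp add: v_def)
  have v: "- 1 / 2 \<le> v" "v < 1" "v \<noteq> 0" using True assms by (auto simp: v_def)
  have "cos (2 * pi * u) = - cos (2 * (pi * v))"
    by (simp add: u cos_add algebra_simps)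
  then have "1 + cos (2 * pi * u) = 2 * (sin (pi * v))\<^sup>2" by (simp add: cos_double_sin)
  moreover have "2 / (2 * u + 1)\<^sup>2 = 1 / 2 * (1 / (1 + v)\<^sup>2)"
  proof -
    have "(2 * u + 1)\<^sup>2 = 4 * (1 + v)\<^sup>2" by (simp add: u power2_eq_square algebra_simps)
    then show ?thesis by simp
  qed
  moreover have "2 / (2 * u - 1)\<^sup>2 = 1 / 2 * (1 / v\<^sup>2)" by (simp add: u power_mult_distrib)
  moreover have "4 / ((3 + 2 * u) * (3 - 2 * u)) = 1 / 2 * (2 / ((1 - v) * (2 + v)))"
  proof -
    have "(3 + 2 * u) * (3 - 2 * u) = 4 * ((1 - v) * (2 + v))" by (simp add: u algebra_simps)
    then show ?thesis by simp
  qed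
  ultimately have "weight u = (sin (pi * v))\<^sup>2 * (1 / v\<^sup>2 + 1 / (1 + v)\<^sup>2 + 2 / ((1 - v) * (2 + v))) / pi\<^sup>2"
  proof -
    assume e: "1 + cos (2 * pi * u) = 2 * (sin (pi * v))\<^sup>2"
      "2 / (2 * u + 1)\<^sup>2 = 1 / 2 * (1 / (1 + v)\<^sup>2)" "2 / (2 * u - 1)\<^sup>2 = 1 / 2 * (1 / v\<^sup>2)"
      "4 / ((3 + 2 * u) * (3 - 2 * u)) = 1 / 2 * (2 / ((1 - v) * (2 + v)))"
    have "u \<noteq> 1 / 2" "u \<noteq> - 1 / 2" "u \<noteq> 3 / 2" "u \<noteq> - 3 / 2" using True assms by auto
    from weight_eq[OF this, unfolded e]
    have "weight u = 2 * (sin (pi * v))\<^sup>2 / pi\<^sup>2 * (1 / 2 * (1 / (1 + v)\<^sup>2)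
        + 1 / 2 * (1 / v\<^sup>2) + 1 / 2 * (2 / ((1 - v) * (2 + v))))" .
    moreover have "2 * S / pi\<^sup>2 * (1 / 2 * a + 1 / 2 * b + 1 / 2 * c) = S * (b + a + c) / pi\<^sup>2"
      for S a b c by (simp add: field_simps)
    ultimately show ?thesis by (simp only:)
  qed
  also have "\<dots> \<le> pi\<^sup>2 / pi\<^sup>2" using four_poles_le[OF v] by (intro divide_right_mono) auto
  finally show ?thesis by simp
next
  case False
  then consider "u = 1 / 2" | "u \<ge> 3 / 2" by linarith
  then show ?thesis
  proof cases
    case 1
    then show ?thesis unfolding 1 by (simp add: weight_half)
  next
    case 2
    then show ?thesis using weight_nonpos_aux[of u] by linarith
  qed
qed

lemma weight_le_one: "weight u \<le> 1"
  using weight_le_one_aux[of u] weight_le_one_aux[of "- u"] weight_minus[of u] by linarith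

section \<open>Fejer means\<close>

text \<open>The Fejer kernel is written as a double sum over index pairs instead of the usual
  single sum with weights 1 - |k|/K. The means then become averages over a Toeplitz matrix, and
  no diagonals have to be counted.\<close>

definition fejer :: "nat \<Rightarrow> real \<Rightarrow> real" where
  "fejer K s = (\<Sum>i<K. \<Sum>j<K. cos (2 * pi * (int i - int j) * s)) / real K"

lemma norm_sum_cis_squared:
  fixes d :: "'i \<Rightarrow> complex" and \<theta> :: "'i \<Rightarrow> real"
  shows "(norm (\<Sum>i\<in>I. d i * cis (\<theta> i)))\<^sup>2
     = (\<Sum>i\<in>I. \<Sum>j\<in>I. Re (d i * cnj (d j) * cis (\<theta> i - \<theta> j)))"
proof -
  have "complex_of_real ((norm (\<Sum>i\<in>I. d i * cis (\<theta> i)))\<^sup>2)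
      = (\<Sum>i\<in>I. d i * cis (\<theta> i)) * cnj (\<Sum>i\<in>I. d i * cis (\<theta> i))"
    by (simp only: complex_norm_square)
  also have "\<dots> = (\<Sum>i\<in>I. \<Sum>j\<in>I. d i * cnj (d j) * cis (\<theta> i - \<theta> j))"
  proof -
    have "cis (a - b) = cis a * cnj (cis b)" for a b
      by (simp add: cis_cnj cis_mult)
    then show ?thesis
      unfolding cnj_sum sum_product by (intro sum.cong refl) (simp add: mult_ac)
  qed
  finally have "Re (complex_of_real ((norm (\<Sum>i\<in>I. d i * cis (\<theta> i)))\<^sup>2))
     = Re (\<Sum>i\<in>I. \<Sum>j\<in>I. d i * cnj (d j) * cis (\<theta> i - \<theta> j))" by simp
  then show ?thesis by (simp only: Re_complex_of_real Re_sum)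
qed

lemma fejer_eq: "fejer K s = (norm (\<Sum>j<K. cis (2 * pi * s) ^ j))\<^sup>2 / real K"
proof -
  have "(norm (\<Sum>j<K. cis (2 * pi * s) ^ j))\<^sup>2 = (norm (\<Sum>j<K. 1 * cis (real j * (2 * pi * s))))\<^sup>2"
    by (intro arg_cong[where f = "\<lambda>z. (norm z)\<^sup>2"] sum.cong refl) (simp only: mult_1 Complex.DeMoivre)
  also have "\<dots> = (\<Sum>i<K. \<Sum>j<K. cos (2 * pi * (int i - int j) * s))"
    unfolding norm_sum_cis_squared by (intro sum.cong refl) (simp add: algebra_simps)
  finally show ?thesis by (simp add: fejer_def)
qed

lemma fejer_nonneg: "fejer K s \<ge> 0"
  by (simp add: fejer_eq)

text \<open>The geometric sum of z^j is at most 2 / |1 - z|.\<close>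

lemma fejer_le:
  assumes "0 < \<eta>" "\<eta> \<le> wrap_dist s 0"
  shows "fejer K s \<le> 1 / (real K * \<eta>\<^sup>2)"
proof -
  define z where "z = cis (2 * pi * s)"
  define S where "S = (\<Sum>j<K. z ^ j)"
  have "norm (1 - z) * norm S = norm (1 - z ^ K)"
    unfolding S_def by (metis norm_mult one_diff_power_eq)
  also have "\<dots> \<le> norm (1::complex) + norm (z ^ K)" by (rule norm_triangle_ineq4)
  also have "\<dots> = 2" by (simp add: z_def norm_power)
  finally have 1: "norm (1 - z) * norm S \<le> 2" .
  have "2 * \<eta> \<le> norm (1 - z)" using norm_one_minus_cis_ge[of s] assms by (simp add: z_def)
  then have "2 * \<eta> * norm S \<le> norm (1 - z) * norm S" by (intro mult_right_mono) auto
  with 1 have "\<eta> * norm S \<le> 1" by linarith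
  then have "norm S \<le> 1 / \<eta>" using assms by (simp add: field_simps)
  then have "(norm S)\<^sup>2 \<le> (1 / \<eta>)\<^sup>2" by (intro power_mono) auto
  then have "(norm S)\<^sup>2 / real K \<le> (1 / \<eta>)\<^sup>2 / real K" by (intro divide_right_mono) auto
  then show ?thesis by (simp add: fejer_eq S_def z_def power_divide mult.commute)
qed

lemma has_integral_cos_half_period:
  fixes m :: int
  shows "((\<lambda>s. cos (2 * pi * m * s)) has_integral (if m = 0 then 1 / 2 else 0)) {0..1/2}"
proof (cases "m = 0")
  case True
  then show ?thesis using has_integral_const_real[of "1::real" 0 "1/2"] by simp
next
  case False
  define F where "F = (\<lambda>s. sin (2 * pi * m * s) / (2 * pi * m))"
  have "((\<lambda>s. cos (2 * pi * m * s)) has_integral (F (1/2) - F 0)) {0..1/2}"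
    using False
    by (intro fundamental_theorem_of_calculus)
       (auto intro!: derivative_eq_intros simp: F_def
             simp flip: has_real_derivative_iff_has_vector_derivative)
  moreover have "sin (pi * m) = 0" by (simp add: sin_zero_iff_int2)
  ultimately show ?thesis using False by (simp add: F_def)
qed

text \<open>The function with values U (wrap_dist t 0) is even and has period 1. Averaging t - s
  and t + s accounts for its values on the negative half period, and the sine parts of the
  Fourier series cancel, so only the cosine coefficients w enter.\<close>

lemma has_integral_fejer_convolution:
  fixes w :: "int \<Rightarrow> real"
  assumes "\<And>m. ((\<lambda>s. 2 * (U s * cos (2 * pi * real_of_int m * s))) has_integral w m) {0..1/2}"
  shows "((\<lambda>s. U s * (fejer K (t - s) + fejer K (t + s))) has_integral
     (\<Sum>i<K. \<Sum>j<K. w (int i - int j) * cos (2 * pi * (int i - int j) * t)) / real K) {0..1/2}"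
proof -
  have "U s * (fejer K (t - s) + fejer K (t + s))
     = (\<Sum>i<K. \<Sum>j<K. 2 * (U s * cos (2 * pi * real_of_int (int i - int j) * s))
          * cos (2 * pi * (int i - int j) * t)) / real K" for s
  proof -
    have "U s * (cos (2 * pi * m * (t - s)) + cos (2 * pi * m * (t + s)))
       = 2 * (U s * cos (2 * pi * m * s)) * cos (2 * pi * m * t)" for m
      by (simp add: distrib_left right_diff_distrib cos_add cos_diff)
    then show ?thesis
      unfolding fejer_def add_divide_distrib[symmetric] sum.distrib[symmetric]
        times_divide_eq_right sum_distrib_left by (simp only:)
  qed
  then show ?thesis
    by (simp only:) (intro has_integral_divide has_integral_sum has_integral_mult_left assms finite_lessThan)
qed

lemma has_integral_fejer:
  assumes "K > 0"
  shows "((\<lambda>s. fejer K (t - s) + fejer K (t + s)) has_integral 1) {0..1/2}"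
proof -
  define w :: "int \<Rightarrow> real" where "w m = 2 * (if m = 0 then 1 / 2 else 0)" for m
  have "((\<lambda>s. 2 * (1 * cos (2 * pi * real_of_int m * s))) has_integral w m) {0..1/2}" for m
    unfolding w_def mult_1 by (intro has_integral_mult_right has_integral_cos_half_period)
  from has_integral_fejer_convolution[of "\<lambda>_. 1", OF this, of K t]
  have "((\<lambda>s. fejer K (t - s) + fejer K (t + s)) has_integral
     (\<Sum>i<K. \<Sum>j<K. w (int i - int j) * cos (2 * pi * (int i - int j) * t)) / real K) {0..1/2}"
    by simp
  moreover have "(\<Sum>i<K. \<Sum>j<K. w (int i - int j) * cos (2 * pi * (int i - int j) * t))
     = (\<Sum>i<K. \<Sum>j<K. if i = j then 1 else 0)"
    by (intro sum.cong refl) (auto simp: w_def)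
  ultimately show ?thesis using assms by simp
qed

text \<open>Fejer's theorem for even functions of period 1. The Fejer kernel is nonnegative with
  integral 1. Where its argument is close to an integer, U s is close to the limit by uniform
  continuity; elsewhere the kernel itself is of order 1/K.\<close>

lemma fejer_means_tendsto:
  fixes U :: "real \<Rightarrow> real" and w :: "int \<Rightarrow> real"
  assumes U: "continuous_on {0..1/2} U"
    and w: "\<And>m. ((\<lambda>s. 2 * (U s * cos (2 * pi * real_of_int m * s))) has_integral w m) {0..1/2}"
  shows "(\<lambda>K. (\<Sum>i<K. \<Sum>j<K. w (int i - int j) * cos (2 * pi * (int i - int j) * t)) / real K)
     \<longlonglongrightarrow> U (wrap_dist t 0)"
proof -
  define \<sigma> where "\<sigma> K = (\<Sum>i<K. \<Sum>j<K. w (int i - int j) * cos (2 * pi * (int i - int j) * t)) / real K" for K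
  define c where "c = U (wrap_dist t 0)"
  have wt: "wrap_dist t 0 \<in> {0..1/2}" using wrap_dist_nonneg wrap_dist_le_half by auto
  have "bounded (U ` {0..1/2})"
    by (intro compact_imp_bounded compact_continuous_image U) auto
  then obtain B where "\<forall>y\<in>U ` {0..1/2}. norm y \<le> B"
    unfolding bounded_iff by blast
  then have B: "\<bar>U s\<bar> \<le> B" if "s \<in> {0..1/2}" for s
    using that by (metis imageI real_norm_def)
  have B0: "B \<ge> 0" using B[of 0] by force
  have "\<sigma> \<longlonglongrightarrow> c"
  proof (rule LIMSEQ_I)
    fix e :: real assume e: "e > 0"
    have "uniformly_continuous_on {0..1/2} U"
      by (intro compact_uniformly_continuous U) auto
    then obtain \<eta> where \<eta>: "\<eta> > 0"
      and close: "\<And>x y. x \<in> {0..1/2} \<Longrightarrow> y \<in> {0..1/2} \<Longrightarrow> \<bar>x - y\<bar> < \<eta> \<Longrightarrow> \<bar>U x - U y\<bar> < e / 2"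
      using e unfolding uniformly_continuous_on_def dist_real_def by (metis half_gt_zero)
    (* makes the error term T below smaller than e/2 *)
    define K0 where "K0 = nat \<lceil>4 * B / (e * \<eta>\<^sup>2)\<rceil> + 1"
    show "\<exists>K0. \<forall>K\<ge>K0. norm (\<sigma> K - c) < e"
    proof (intro exI allI impI)
      fix K assume "K \<ge> K0"
      then have K: "K > 0" "real K > 4 * B / (e * \<eta>\<^sup>2)" unfolding K0_def by linarith+
      define T where "T = 2 * B / (real K * \<eta>\<^sup>2)"
      have T: "T < e / 2" "T \<ge> 0"
        unfolding T_def using K e \<eta> B0 by (auto simp: field_simps)
      have pt: "\<bar>U s - c\<bar> * fejer K x \<le> e / 2 * fejer K x + T"
        if "s \<in> {0..1/2}" "\<bar>s - wrap_dist t 0\<bar> \<le> wrap_dist x 0" for s x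
      proof (cases "wrap_dist x 0 < \<eta>")
        case True
        then have "\<bar>U s - c\<bar> \<le> e / 2"
          unfolding c_def using close[of s "wrap_dist t 0"] that wt by linarith
        then have "\<bar>U s - c\<bar> * fejer K x \<le> e / 2 * fejer K x"
          by (intro mult_right_mono fejer_nonneg)
        then show ?thesis using T by linarith
      next
        case False
        have "\<bar>U s - c\<bar> * fejer K x \<le> (2 * B) * (1 / (real K * \<eta>\<^sup>2))"
          using B[OF that(1)] B[OF wt] False \<eta> B0
          by (intro mult_mono fejer_le fejer_nonneg) (auto simp: c_def)
        also have "\<dots> = T" by (simp add: T_def)
        finally show ?thesis using e fejer_nonneg[of K x] by (simp add: add.commute add_increasing2)
      qed
      define g where "g s = (U s - c) * (fejer K (t - s) + fejer K (t + s))" for s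
      define h where "h s = e / 2 * (fejer K (t - s) + fejer K (t + s)) + 2 * T" for s
      have g: "(g has_integral \<sigma> K - c) {0..1/2}"
        using has_integral_diff[OF has_integral_fejer_convolution[OF w, of K t]
            has_integral_mult_right[OF has_integral_fejer[OF K(1), of t], of c]]
        by (simp add: g_def[abs_def] \<sigma>_def left_diff_distrib)
      have h: "(h has_integral e / 2 + T) {0..1/2}"
        using has_integral_add[OF has_integral_mult_right[OF has_integral_fejer[OF K(1), of t], of "e / 2"]
            has_integral_const_real[of "2 * T" 0 "1/2"]]
        by (simp add: h_def[abs_def])
      have gh: "\<bar>g s\<bar> \<le> h s" if s: "s \<in> {0..1/2}" for s
      proof -
        have "\<bar>wrap_dist s 0 - wrap_dist t 0\<bar> \<le> wrap_dist (t - s) 0"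
          "\<bar>wrap_dist (- s) 0 - wrap_dist t 0\<bar> \<le> wrap_dist (t + s) 0"
          using wrap_dist_perturb[of s t] wrap_dist_perturb[of "- s" t]
            wrap_dist_commute[of s t] wrap_dist_commute[of "- s" t]
            wrap_dist_diff[of t s] wrap_dist_diff[of t "- s"] by auto
        then have "\<bar>s - wrap_dist t 0\<bar> \<le> wrap_dist (t - s) 0" "\<bar>s - wrap_dist t 0\<bar> \<le> wrap_dist (t + s) 0"
          using s wrap_dist_small[of s] wrap_dist_small[of "- s"] by auto
        from pt[OF s this(1)] pt[OF s this(2)]
        have "\<bar>U s - c\<bar> * (fejer K (t - s) + fejer K (t + s)) \<le> h s"
          by (simp add: h_def distrib_left)
        then show ?thesis
          by (simp add: g_def abs_mult abs_of_nonneg fejer_nonneg)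
      qed
      have "\<sigma> K - c \<le> e / 2 + T" using has_integral_le[OF g h] gh by fastforce
      moreover have "- (\<sigma> K - c) \<le> e / 2 + T"
        using has_integral_le[OF has_integral_neg[OF g] h] gh by fastforce
      ultimately show "norm (\<sigma> K - c) < e" using T by (simp add: abs_less_iff) 
    qed
  qed
  then show ?thesis unfolding \<sigma>_def c_def .
qed

section \<open>A minorant bounds the energy from below\<close>

lemma sum_Re_cos:
  fixes d :: "'i \<Rightarrow> complex" and x :: "'i \<Rightarrow> real" and m :: real
  shows "(\<Sum>i\<in>I. \<Sum>j\<in>I. Re (d i * cnj (d j)) * cos (2 * pi * m * (x i - x j)))
    = ((norm (\<Sum>i\<in>I. d i * cis (2 * pi * m * x i)))\<^sup>2
      + (norm (\<Sum>i\<in>I. d i * cis (2 * pi * (- m) * x i)))\<^sup>2) / 2"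
proof -
  have "Re z * cos (2 * pi * m * (a - b)) = (Re (z * cis (2 * pi * m * a - 2 * pi * m * b))
      + Re (z * cis (2 * pi * (- m) * a - 2 * pi * (- m) * b))) / 2" for z a b
  proof -
    define \<theta> where "\<theta> = 2 * pi * m * (a - b)"
    have "2 * pi * m * a - 2 * pi * m * b = \<theta>" "2 * pi * (- m) * a - 2 * pi * (- m) * b = - \<theta>"
      by (simp_all add: \<theta>_def algebra_simps)
    then show ?thesis by (simp only: \<theta>_def[symmetric]) simp
  qed
  then show ?thesis
    unfolding norm_sum_cis_squared sum.distrib[symmetric] sum_divide_distrib by (simp only:)
qed

lemma toeplitz_mean_le:
  fixes A :: "int \<Rightarrow> real"
  assumes "\<And>m. A m \<ge> 0" "\<And>m. \<bar>m\<bar> > int N \<Longrightarrow> A m = 0"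
  shows "(\<Sum>i<K. \<Sum>j<K. A (int i - int j)) / real K \<le> (\<Sum>m=-int N..int N. A m)"
proof (cases "K = 0")
  case True
  then show ?thesis using assms by (auto intro: sum_nonneg)
next
  case False
  have "(\<Sum>j<K. A (int i - int j)) \<le> (\<Sum>m=-int N..int N. A m)" for i
  proof -
    have "(\<Sum>j<K. A (int i - int j)) = sum A ((\<lambda>j. int i - int j) ` {..<K})"
      by (subst sum.reindex) (auto simp: inj_on_def)
    also have "\<dots> = sum A ((\<lambda>j. int i - int j) ` {..<K} \<inter> {-int N..int N})"
      by (rule sum.mono_neutral_right) (auto intro!: assms(2))
    also have "\<dots> \<le> (\<Sum>m=-int N..int N. A m)"
      by (intro sum_mono2) (auto simp: assms)
    finally show ?thesis .
  qed
  then have "(\<Sum>i<K. \<Sum>j<K. A (int i - int j)) \<le> (\<Sum>i<K. \<Sum>m=-int N..int N. A m)"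
    by (intro sum_mono)
  then show ?thesis using False by (simp add: field_simps)
qed

lemma sum_int_symmetric:
  fixes a :: "int \<Rightarrow> 'a::comm_monoid_add"
  shows "(\<Sum>m=-int N..int N. a (- m)) = (\<Sum>m=-int N..int N. a m)"
  by (rule sum.reindex_bij_witness[of _ uminus uminus]) auto

text \<open>Writing the kernel as its Fourier series turns the left-hand side into the sum over
  all integers m of w m times the energy of the exponential sum at m; this is at most the energy
  on [-N, N] because the weight is at most 1 there and nonpositive outside. Using Fejer means
  instead of the series avoids every question of convergence, because each mean satisfies the
  inequality already. Frequencies are indexed by an arbitrary set, so that equal frequencies may
  occur more than once.\<close>

lemma minorant_energy_le:
  fixes U :: "real \<Rightarrow> real" and w :: "int \<Rightarrow> real" and d :: "'i \<Rightarrow> complex" and x :: "'i \<Rightarrow> real"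
  assumes U: "continuous_on {0..1/2} U"
    and w: "\<And>m. ((\<lambda>s. 2 * (U s * cos (2 * pi * real_of_int m * s))) has_integral w m) {0..1/2}"
    and w1: "\<And>m. w m \<le> 1" and w0: "\<And>m. \<bar>m\<bar> > int N \<Longrightarrow> w m \<le> 0"
  shows "(\<Sum>i\<in>I. \<Sum>j\<in>I. Re (d i * cnj (d j)) * U (wrap_dist (x i) (x j)))
    \<le> (\<Sum>m=-int N..int N. (norm (\<Sum>i\<in>I. d i * cis (2 * pi * m * x i)))\<^sup>2)"
proof -
  define e where "e m = (norm (\<Sum>i\<in>I. d i * cis (2 * pi * real_of_int m * x i)))\<^sup>2" for m :: int
  define A where "A m = (if \<bar>m\<bar> \<le> int N then (e m + e (- m)) / 2 else 0)" for m
  define \<sigma> where "\<sigma> t K = (\<Sum>a<K. \<Sum>b<K. w (int a - int b) * cos (2 * pi * (int a - int b) * t)) / real K" for t K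
  have e0: "e m \<ge> 0" for m by (simp add: e_def)
  have lim: "(\<lambda>K. \<Sum>i\<in>I. \<Sum>j\<in>I. Re (d i * cnj (d j)) * \<sigma> (x i - x j) K) \<longlonglongrightarrow>
     (\<Sum>i\<in>I. \<Sum>j\<in>I. Re (d i * cnj (d j)) * U (wrap_dist (x i - x j) 0))"
    unfolding \<sigma>_def by (intro tendsto_sum tendsto_mult tendsto_const fejer_means_tendsto U w)
  have "(\<Sum>i\<in>I. \<Sum>j\<in>I. Re (d i * cnj (d j)) * \<sigma> (x i - x j) K) \<le> (\<Sum>m=-int N..int N. e m)" for K
  proof -
    have "(\<Sum>i\<in>I. \<Sum>j\<in>I. Re (d i * cnj (d j)) * \<sigma> (x i - x j) K)
      = (\<Sum>i\<in>I. \<Sum>j\<in>I. \<Sum>a<K. \<Sum>b<K. w (int a - int b)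
           * (Re (d i * cnj (d j)) * cos (2 * pi * (int a - int b) * (x i - x j)))) / real K"
      unfolding \<sigma>_def sum_divide_distrib sum_distrib_left
      by (intro sum.cong refl) simp
    also have "(\<Sum>i\<in>I. \<Sum>j\<in>I. \<Sum>a<K. \<Sum>b<K. w (int a - int b)
           * (Re (d i * cnj (d j)) * cos (2 * pi * (int a - int b) * (x i - x j))))
      = (\<Sum>i\<in>I. \<Sum>a<K. \<Sum>b<K. \<Sum>j\<in>I. w (int a - int b)
           * (Re (d i * cnj (d j)) * cos (2 * pi * (int a - int b) * (x i - x j))))"
      by (rule sum.cong[OF refl], subst sum.swap, intro sum.cong refl, rule sum.swap)
    also have "\<dots> = (\<Sum>a<K. \<Sum>b<K. \<Sum>i\<in>I. \<Sum>j\<in>I. w (int a - int b)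
           * (Re (d i * cnj (d j)) * cos (2 * pi * (int a - int b) * (x i - x j))))"
      by (subst sum.swap, intro sum.cong refl, rule sum.swap)
    also have "\<dots> = (\<Sum>a<K. \<Sum>b<K. w (int a - int b) * ((e (int a - int b) + e (- (int a - int b))) / 2))"
      unfolding sum_distrib_left[symmetric] sum_Re_cos e_def of_int_minus ..
    also have "\<dots> \<le> (\<Sum>a<K. \<Sum>b<K. A (int a - int b))"
    proof (intro sum_mono)
      fix a b
      have "w m * ((e m + e (- m)) / 2) \<le> A m" for m
      proof (cases "\<bar>m\<bar> \<le> int N")
        case True
        have "w m * ((e m + e (- m)) / 2) \<le> 1 * ((e m + e (- m)) / 2)"
          using w1 e0 by (intro mult_right_mono) auto
        then show ?thesis using True by (simp add: A_def)
      next
        case False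
        then have "w m * ((e m + e (- m)) / 2) \<le> 0"
          using w0[of m] e0 by (intro mult_nonpos_nonneg) auto
        then show ?thesis using False by (simp add: A_def)
      qed
      then show "w (int a - int b) * ((e (int a - int b) + e (- (int a - int b))) / 2) \<le> A (int a - int b)" .
    qed
    finally have "(\<Sum>i\<in>I. \<Sum>j\<in>I. Re (d i * cnj (d j)) * \<sigma> (x i - x j) K)
       \<le> (\<Sum>a<K. \<Sum>b<K. A (int a - int b)) / real K" by (simp add: divide_right_mono)
    also have "\<dots> \<le> (\<Sum>m=-int N..int N. A m)"
      by (rule toeplitz_mean_le) (auto simp: A_def e0)
    also have "\<dots> = (\<Sum>m=-int N..int N. (e m + e (- m)) / 2)"
      by (intro sum.cong) (auto simp: A_def)
    also have "\<dots> = (\<Sum>m=-int N..int N. e m)"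
      unfolding sum_divide_distrib[symmetric] sum.distrib sum_int_symmetric by simp
    finally show ?thesis .
  qed
  from LIMSEQ_le_const2[OF lim] this
  have "(\<Sum>i\<in>I. \<Sum>j\<in>I. Re (d i * cnj (d j)) * U (wrap_dist (x i - x j) 0)) \<le> (\<Sum>m=-int N..int N. e m)"
    by blast
  then show ?thesis unfolding e_def wrap_dist_diff .
qed

section \<open>Localized kernels\<close>

lemma profile_0: "profile 0 = 2"
  by (simp add: profile_def)

lemma profile_1: "profile 1 = 0"
proof -
  have "3 * pi = pi + 2 * pi" by simp
  then have "sin (3 * pi) = 0" by (metis sin_periodic sin_pi)
  then show ?thesis by (simp add: profile_def)
qed

definition minorant_pair :: "nat \<Rightarrow> (real \<Rightarrow> real) \<Rightarrow> (int \<Rightarrow> real) \<Rightarrow> bool" where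
  "minorant_pair N U w \<longleftrightarrow> continuous_on {0..1/2} U \<and>
    (\<forall>m. ((\<lambda>s. 2 * (U s * cos (2 * pi * real_of_int m * s))) has_integral w m) {0..1/2}) \<and>
    (\<forall>m. w m \<le> 1) \<and> (\<forall>m. \<bar>m\<bar> > int N \<longrightarrow> w m \<le> 0)"

text \<open>The two lower bounds concern half the eigenvalues of the 2x2 matrix with entries U 0
  on the diagonal and U r off the diagonal, which describes the interaction of two frequencies
  at distance r. The eigenvectors are (1,1) and (1,-1); this is why the sum and the difference
  of the coefficients are what can be controlled.\<close>

definition localized :: "nat \<Rightarrow> (real \<Rightarrow> real) \<Rightarrow> bool" where
  "localized N U \<longleftrightarrow> U 0 \<ge> 4 * (real N + 1) / 3 \<and>
    (\<forall>r\<in>{0..1/2}. (3 / (2 * real N + 2) \<le> r \<longrightarrow> U r = 0) \<and> (r < 3 / (2 * real N + 2) \<longrightarrow>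
      (U 0 + U r) / 2 \<ge> (real N + 1) / 3 \<and>
      (U 0 - U r) / 2 \<ge> 2 * pi\<^sup>2 * (real N + 1) ^ 3 / 3 ^ 5 * r\<^sup>2))"

text \<open>For N = 1 the support radius 3/(2N+2) = 3/4 exceeds 1/2, so a kernel on the circle
  cannot be obtained by rescaling the profile. But then no distance reaches this radius and
  nothing has to vanish: the Dirichlet kernel, whose weight is the indicator function of {-1, 0,
  1}, can be used.\<close>

lemma dirichlet_minorant:
  "minorant_pair 1 (\<lambda>r. 1 + 2 * cos (2 * pi * r)) (\<lambda>m. if \<bar>m\<bar> \<le> 1 then 1 else 0)"
  unfolding minorant_pair_def
proof (intro conjI allI impI)
  fix m :: int
  define \<delta> where "\<delta> m = (if m = 0 then 1 / 2 else 0 :: real)" for m :: int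
  have "2 * ((1 + 2 * cos (2 * pi * s)) * cos (2 * pi * real_of_int m * s))
    = 2 * cos (2 * pi * real_of_int m * s) + 2 * cos (2 * pi * real_of_int (m + 1) * s)
      + 2 * cos (2 * pi * real_of_int (m - 1) * s)" for s
  proof -
    have e: "2 * pi * real_of_int (m + 1) * s = 2 * pi * real_of_int m * s + 2 * pi * s"
      "2 * pi * real_of_int (m - 1) * s = 2 * pi * real_of_int m * s - 2 * pi * s"
      by (simp_all add: algebra_simps)
    show ?thesis unfolding e cos_add cos_diff by (simp add: distrib_right)
  qed
  moreover have "(if \<bar>m\<bar> \<le> 1 then 1 else 0) = 2 * \<delta> m + 2 * \<delta> (m + 1) + 2 * \<delta> (m - 1)"
    by (auto simp: \<delta>_def)
  ultimately show "((\<lambda>s. 2 * ((1 + 2 * cos (2 * pi * s)) * cos (2 * pi * real_of_int m * s)))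
      has_integral (if \<bar>m\<bar> \<le> 1 then 1 else 0)) {0..1/2}"
    by (simp only:) (unfold \<delta>_def, intro has_integral_add has_integral_mult_right has_integral_cos_half_period)
qed (auto intro!: continuous_intros)

lemma dirichlet_localized: "localized 1 (\<lambda>r. 1 + 2 * cos (2 * pi * r))"
proof -
  have bound: "2 * pi\<^sup>2 * 2 ^ 3 / 3 ^ 5 * r\<^sup>2 \<le> 1 - cos (2 * pi * r)" if "0 \<le> r" "r \<le> 1 / 2" for r
  proof -
    have "r\<^sup>2 \<le> (sin (pi * r))\<^sup>2" using le_sin_pi_times[OF that] that by (intro power_mono)
    then have "2 * r\<^sup>2 \<le> 1 - cos (2 * pi * r)"
      using cos_double_sin[of "pi * r"] by (simp add: mult.assoc)
    moreover have "2 * pi\<^sup>2 * 2 ^ 3 / 3 ^ 5 * r\<^sup>2 \<le> 2 * r\<^sup>2"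
      using pi_squared_less_10 by (intro mult_right_mono) auto
    ultimately show ?thesis by linarith
  qed
  show ?thesis
    unfolding localized_def
  proof (intro conjI ballI impI)
    fix r :: real assume r: "r \<in> {0..1/2}"
    show "(real 1 + 1) / 3 \<le> (1 + 2 * cos (2 * pi * 0) + (1 + 2 * cos (2 * pi * r))) / 2"
    proof -
      have "(1 + 1) / 3 \<le> (1 + 2 + (1 + 2 * c)) / 2" if "-1 \<le> c" for c :: real using that by simp
      from this[OF cos_ge_minus_one[of "2 * pi * r"]] show ?thesis by simp
    qed
    show "2 * pi\<^sup>2 * (real 1 + 1) ^ 3 / 3 ^ 5 * r\<^sup>2
       \<le> (1 + 2 * cos (2 * pi * 0) - (1 + 2 * cos (2 * pi * r))) / 2"
      using bound[of r] r by simp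
    show "1 + 2 * cos (2 * pi * r) = 0" if "3 / (2 * real 1 + 2) \<le> r" using that r by simp
  qed simp
qed

text \<open>Truncation of the argument at 1, where the profile vanishes, extends the function by
  0 and keeps continuity visible.\<close>

definition scaled_profile :: "real \<Rightarrow> real \<Rightarrow> real" where
  "scaled_profile L r = L * profile (min 1 (L * r))"

lemma has_integral_scaled_profile:
  assumes "L \<ge> 2"
  shows "((\<lambda>s. 2 * (scaled_profile L s * cos (2 * pi * m * s))) has_integral weight (m / L)) {0..1/2}"
proof -
  define f where "f s = 2 * (profile s * cos (2 * pi * (m / L) * s))" for s
  have "(f has_integral weight (m / L)) {0..1}"
    unfolding f_def[abs_def] by (rule has_integral_weight)
  then have "((\<lambda>s. f (L * s)) has_integral (1 / \<bar>L\<bar>) * weight (m / L)) ((\<lambda>s. s / L) ` {0..1})"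
    using assms has_integral_stretch_real[of f "weight (m / L)" 0 1 L] by simp
  moreover have "(\<lambda>s. s / L) ` {0..1} = {0..1 / L}"
    using assms image_affinity_atLeastAtMost_div[of L 0 0 1] by simp
  ultimately have "((\<lambda>s. L * f (L * s)) has_integral L * (1 / \<bar>L\<bar> * weight (m / L))) {0..1 / L}"
    by (intro has_integral_mult_right) simp
  then have "((\<lambda>s. L * f (L * s)) has_integral weight (m / L)) {0..1 / L}"
    using assms by simp
  then have 1: "((\<lambda>s. 2 * (scaled_profile L s * cos (2 * pi * m * s))) has_integral weight (m / L)) {0..1 / L}"
    using assms by (elim has_integral_eq[rotated]) (auto simp: scaled_profile_def f_def field_simps min_def)
  have 2: "((\<lambda>s. 2 * (scaled_profile L s * cos (2 * pi * m * s))) has_integral 0) {1 / L..1/2}"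
    using assms by (intro has_integral_is_0) (auto simp: scaled_profile_def field_simps min_def profile_1)
  show ?thesis
    using has_integral_combine[OF _ _ 1 2] assms by (simp add: field_simps)
qed

text \<open>The dilation is chosen such that the integer m corresponds to the point u =
  3m/(2(N+1)). So |m| > N means |u| >= 3/2, exactly the region where the weight is
  nonpositive.\<close>

lemma scaled_profile_minorant:
  assumes "N \<ge> 2"
  shows "minorant_pair N (scaled_profile (2 * (real N + 1) / 3)) (\<lambda>m. weight (m / (2 * (real N + 1) / 3)))"
proof -
  define L where "L = 2 * (real N + 1) / 3"
  have L: "L \<ge> 2" using assms by (simp add: L_def)
  have "weight (m / L) \<le> 0" if "\<bar>m\<bar> > int N" for m :: int
  proof (rule weight_nonpos)
    have "\<bar>real_of_int m\<bar> \<ge> real N + 1" using that by linarith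
    then have "\<bar>real_of_int m\<bar> \<ge> 3 / 2 * L" by (simp add: L_def)
    then show "3 / 2 \<le> \<bar>m / L\<bar>" using L by (simp add: abs_divide field_simps)
  qed
  moreover have cont: "continuous_on {0..1/2} (scaled_profile L)"
    unfolding scaled_profile_def[abs_def] profile_def by (intro continuous_intros) auto
  ultimately show ?thesis
    unfolding minorant_pair_def L_def[symmetric] using L
    by (intro conjI allI impI has_integral_scaled_profile weight_le_one cont)
qed

lemma scaled_profile_localized:
  assumes "N \<ge> 2"
  shows "localized N (scaled_profile (2 * (real N + 1) / 3))"
proof -
  define M where "M = real N + 1"
  define L where "L = 2 * M / 3"
  have L: "L \<ge> 2" using assms by (simp add: L_def M_def)
  have k0: "scaled_profile L 0 = 2 * L" by (simp add: scaled_profile_def profile_0)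
  have eq: "2 * (real N + 1) / 3 = L" by (simp add: L_def M_def)
  have bounds: "(scaled_profile L 0 + scaled_profile L r) / 2 \<ge> M / 3"
     "(scaled_profile L 0 - scaled_profile L r) / 2 \<ge> 2 * pi\<^sup>2 * M ^ 3 / 3 ^ 5 * r\<^sup>2"
    if r: "0 \<le> r" "r < 3 / (2 * M)" for r
  proof -
    define t where "t = L * r"
    have "t \<le> L * (3 / (2 * M))" unfolding t_def using r L by (intro mult_left_mono) auto
    also have "\<dots> = 1" using L by (simp add: L_def)
    finally have t: "0 \<le> t" "t \<le> 1" using r L by (auto simp: t_def)
    have k: "scaled_profile L r = L * profile t" using t by (simp add: scaled_profile_def t_def)
    have "L * profile t \<ge> L * (-1)" using profile_ge[OF t] L by (intro mult_left_mono) auto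
    then show "M / 3 \<le> (scaled_profile L 0 + scaled_profile L r) / 2" by (simp add: k k0) (simp add: L_def)
    have "2 * pi\<^sup>2 * M ^ 3 / 3 ^ 5 * r\<^sup>2 = L * (pi\<^sup>2 * t\<^sup>2 / 18) / 2"
      by (simp add: L_def t_def power2_eq_square power3_eq_cube)
    also have "\<dots> \<le> L * (2 - profile t) / 2"
      using profile_le[OF t] L by (intro divide_right_mono mult_left_mono) auto
    also have "\<dots> = (scaled_profile L 0 - scaled_profile L r) / 2" by (simp add: k k0 algebra_simps)
    finally show "2 * pi\<^sup>2 * M ^ 3 / 3 ^ 5 * r\<^sup>2 \<le> (scaled_profile L 0 - scaled_profile L r) / 2" .
  qed
  have "scaled_profile L r = 0" if "r \<ge> 3 / (2 * M)" for r
  proof -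
    have "L * r \<ge> 1" using that L by (simp add: L_def field_simps)
    then show ?thesis by (simp add: scaled_profile_def profile_1 min_def)
  qed
  moreover have "3 / (2 * real N + 2) = 3 / (2 * M)" by (simp add: M_def)
  moreover have "scaled_profile L 0 \<ge> 4 * M / 3" unfolding k0 by (simp add: L_def)
  ultimately have "localized N (scaled_profile L)"
    using bounds unfolding localized_def M_def[symmetric] by (auto simp del: times_divide_eq_left)
  then show ?thesis by (simp only: eq)
qed

section \<open>Matching the frequencies\<close>

lemma exp_sums_sepD:
  assumes "f \<in> exp_sums_sep r"
  shows "finite (freqs f)"
    and "f x = (\<Sum>y\<in>freqs f. coeffs_of f y * cis (2 * pi * x * y))"
    and "\<And>y y'. y \<in> freqs f \<Longrightarrow> y' \<in> freqs f \<Longrightarrow> y \<noteq> y' \<Longrightarrow> wrap_dist y y' \<ge> r"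
proof -
  obtain Y c where rep: "exp_sum_rep f Y c"
    using assms by (auto simp: exp_sums_sep_def exp_sums_def)
  note Y = freqs_eq[OF rep] and c = coeffs_of_eq[OF rep]
  show "finite (freqs f)" using rep by (simp add: Y exp_sum_rep_def)
  have "f x = (\<Sum>y\<in>Y. c y * exp (2 * of_real pi * \<i> * of_real (y * x)))"
    using rep by (simp add: exp_sum_rep_def)
  also have "\<dots> = (\<Sum>y\<in>Y. coeffs_of f y * cis (2 * pi * x * y))"
    by (intro sum.cong refl) (simp add: c cis_conv_exp mult_ac)
  finally show "f x = (\<Sum>y\<in>freqs f. coeffs_of f y * cis (2 * pi * x * y))" by (simp add: Y)
  show "wrap_dist y y' \<ge> r" if "y \<in> freqs f" "y' \<in> freqs f" "y \<noteq> y'" for y y'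
    using assms that by (auto simp: exp_sums_sep_def sep_ge_iff)
qed

lemma wrap_dist_self: "wrap_dist y y = 0"
  using wrap_dist_le[of y y 0] wrap_dist_nonneg[of y y] by simp

lemma quadratic_form_separated:
  fixes a :: "real \<Rightarrow> complex"
  assumes "finite F" and "\<And>y y'. y \<in> F \<Longrightarrow> y' \<in> F \<Longrightarrow> y \<noteq> y' \<Longrightarrow> U (wrap_dist y y') = 0"
  shows "(\<Sum>y\<in>F. \<Sum>y'\<in>F. Re (a y * cnj (a y')) * U (wrap_dist y y')) = U 0 * (\<Sum>y\<in>F. (norm (a y))\<^sup>2)"
  unfolding sum_distrib_left
proof (intro sum.cong refl)
  have norm: "Re (z * cnj z) = (norm z)\<^sup>2" for z
    by (metis complex_norm_square Re_complex_of_real)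
  fix y assume y: "y \<in> F"
  have "(\<Sum>y'\<in>F. Re (a y * cnj (a y')) * U (wrap_dist y y'))
     = (\<Sum>y'\<in>F. if y' = y then U 0 * (norm (a y))\<^sup>2 else 0)"
    using assms y by (intro sum.cong refl) (auto simp: wrap_dist_self norm simp del: times_complex.sel)
  also have "\<dots> = U 0 * (norm (a y))\<^sup>2" using assms y by simp
  finally show "(\<Sum>y'\<in>F. Re (a y * cnj (a y')) * U (wrap_dist y y')) = U 0 * (norm (a y))\<^sup>2" .
qed

lemma pair_form:
  fixes a b :: complex and u v :: real
  shows "(u + v) / 2 * (norm (a - b))\<^sup>2 + (u - v) / 2 * (norm (a + b))\<^sup>2
    = u * (norm a)\<^sup>2 + u * (norm b)\<^sup>2 - 2 * (Re (a * cnj b) * v)"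
  unfolding cmod_power2 by (simp add: power2_eq_square field_simps)

text \<open>Frequencies at distance at least rho do not interact. Within F and within G this
  leaves the diagonal. Across, the separation 2 rho and the triangle inequality leave at most
  one partner for each element, so the quadratic form decouples into pairs and singles. Singles
  of G are nonnegative and dropped. The disjoint sum keeps a frequency common to F and G apart
  as two indices.\<close>

lemma matched_energy_le:
  fixes a b :: "real \<Rightarrow> complex" and U :: "real \<Rightarrow> real"
  assumes fin: "finite F" "finite G"
    and sepF: "\<And>y y'. y \<in> F \<Longrightarrow> y' \<in> F \<Longrightarrow> y \<noteq> y' \<Longrightarrow> wrap_dist y y' \<ge> 2 * \<rho>"
    and sepG: "\<And>y y'. y \<in> G \<Longrightarrow> y' \<in> G \<Longrightarrow> y \<noteq> y' \<Longrightarrow> wrap_dist y y' \<ge> 2 * \<rho>"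
    and \<rho>: "\<rho> > 0" and U: "\<And>r. r \<in> {0..1/2} \<Longrightarrow> r \<ge> \<rho> \<Longrightarrow> U r = 0" "U 0 \<ge> 0"
    and P: "P \<subseteq> F" "\<And>y. y \<in> P \<Longrightarrow> n y \<in> G \<and> wrap_dist y (n y) < \<rho>"
    and unmatched: "\<And>y z. y \<in> F - P \<Longrightarrow> z \<in> G \<Longrightarrow> wrap_dist y z \<ge> \<rho>"
  shows "U 0 * (\<Sum>y\<in>F - P. (norm (a y))\<^sup>2) + (\<Sum>y\<in>P.
       (U 0 + U (wrap_dist y (n y))) / 2 * (norm (a y - b (n y)))\<^sup>2
     + (U 0 - U (wrap_dist y (n y))) / 2 * (norm (a y + b (n y)))\<^sup>2)
   \<le> (\<Sum>i\<in>F <+> G. \<Sum>j\<in>F <+> G. Re (case_sum a (\<lambda>z. - b z) i * cnj (case_sum a (\<lambda>z. - b z) j))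
         * U (wrap_dist (case_sum id id i) (case_sum id id j)))"
proof -
  have U0: "U (wrap_dist y z) = 0" if "wrap_dist y z \<ge> \<rho>" for y z
    using U(1) that wrap_dist_nonneg[of y z] wrap_dist_le_half[of y z] by simp
  have unique: "z = n y" if "y \<in> P" "z \<in> G" "wrap_dist y z < \<rho>" for y z
  proof (rule ccontr)
    assume "z \<noteq> n y"
    then have "2 * \<rho> \<le> wrap_dist z (n y)" using that P by (intro sepG) auto
    then show False
      using wrap_dist_triangle[of z "n y" y] wrap_dist_commute[of y z] P(2)[of y] that by linarith
  qed
  have inj: "inj_on n P"
  proof (rule inj_onI, rule ccontr)
    fix y y' assume y: "y \<in> P" "y' \<in> P" "n y = n y'" "y \<noteq> y'"
    then have "2 * \<rho> \<le> wrap_dist y y'" using P by (intro sepF) auto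
    then show False
      using wrap_dist_triangle[of y y' "n y"] wrap_dist_commute[of y' "n y"] P(2)[of y] P(2)[of y'] y
      by simp
  qed
  have finP: "finite P" using P fin finite_subset by blast
  define X where "X y = Re (a y * cnj (b (n y))) * U (wrap_dist y (n y))" for y
  have cross: "(\<Sum>y\<in>F. \<Sum>z\<in>G. Re (a y * cnj (- b z)) * U (wrap_dist y z)) = - sum X P"
  proof -
    have "(\<Sum>z\<in>G. Re (a y * cnj (- b z)) * U (wrap_dist y z)) = (if y \<in> P then - X y else 0)"
      if y: "y \<in> F" for y
    proof (cases "y \<in> P")
      case True
      have "(\<Sum>z\<in>G. Re (a y * cnj (- b z)) * U (wrap_dist y z)) = (\<Sum>z\<in>G. if z = n y then - X y else 0)"
      proof (intro sum.cong refl)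
        fix z assume z: "z \<in> G"
        show "Re (a y * cnj (- b z)) * U (wrap_dist y z) = (if z = n y then - X y else 0)"
        proof (cases "z = n y")
          case True
          then show ?thesis by (simp add: X_def algebra_simps)
        next
          case False
          then have "wrap_dist y z \<ge> \<rho>" using unique[OF \<open>y \<in> P\<close> z] by linarith
          then show ?thesis using False by (simp add: U0)
        qed
      qed
      then show ?thesis using True P fin by simp
    next
      case False
      then show ?thesis using U0 unmatched y by simp
    qed
    then have "(\<Sum>y\<in>F. \<Sum>z\<in>G. Re (a y * cnj (- b z)) * U (wrap_dist y z))
      = (\<Sum>y\<in>F. if y \<in> P then - X y else 0)" by (intro sum.cong refl)
    also have "\<dots> = (\<Sum>y\<in>P. - X y)"
      using fin P by (subst sum.inter_restrict[symmetric]) (auto simp: Int_absorb1)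
    finally show ?thesis by (simp add: sum_negf)
  qed
  have cross': "(\<Sum>z\<in>G. \<Sum>y\<in>F. Re (- b z * cnj (a y)) * U (wrap_dist z y)) = - sum X P"
    unfolding cross[symmetric] by (subst sum.swap) (simp add: wrap_dist_commute algebra_simps)
  have diagF: "(\<Sum>y\<in>F. \<Sum>y'\<in>F. Re (a y * cnj (a y')) * U (wrap_dist y y')) = U 0 * (\<Sum>y\<in>F. (norm (a y))\<^sup>2)"
    using sepF \<rho> by (intro quadratic_form_separated fin U0) force
  have diagG: "(\<Sum>y\<in>G. \<Sum>y'\<in>G. Re (- b y * cnj (- b y')) * U (wrap_dist y y')) = U 0 * (\<Sum>y\<in>G. (norm (- b y))\<^sup>2)"
    using sepG \<rho> by (intro quadratic_form_separated fin U0) force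
  have "(\<Sum>i\<in>F <+> G. \<Sum>j\<in>F <+> G. Re (case_sum a (\<lambda>z. - b z) i * cnj (case_sum a (\<lambda>z. - b z) j))
         * U (wrap_dist (case_sum id id i) (case_sum id id j)))
     = U 0 * (\<Sum>y\<in>F. (norm (a y))\<^sup>2) - 2 * sum X P + U 0 * (\<Sum>z\<in>G. (norm (b z))\<^sup>2)"
    using cross cross' diagF diagG fin by (simp add: sum.Plus sum.distrib o_def)
  moreover have "(\<Sum>y\<in>P. (norm (b (n y)))\<^sup>2) \<le> (\<Sum>z\<in>G. (norm (b z))\<^sup>2)"
  proof -
    have "(\<Sum>y\<in>P. (norm (b (n y)))\<^sup>2) = (\<Sum>z\<in>n ` P. (norm (b z))\<^sup>2)"
      by (simp add: sum.reindex[OF inj])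
    also have "\<dots> \<le> (\<Sum>z\<in>G. (norm (b z))\<^sup>2)" using P fin by (intro sum_mono2) auto
    finally show ?thesis .
  qed
  then have "U 0 * (\<Sum>y\<in>P. (norm (b (n y)))\<^sup>2) \<le> U 0 * (\<Sum>z\<in>G. (norm (b z))\<^sup>2)"
    using U(2) by (intro mult_left_mono)
  moreover have "(\<Sum>y\<in>F. (norm (a y))\<^sup>2) = (\<Sum>y\<in>F - P. (norm (a y))\<^sup>2) + (\<Sum>y\<in>P. (norm (a y))\<^sup>2)"
    using fin P by (intro sum.subset_diff) auto
  moreover have "(\<Sum>y\<in>P. (U 0 + U (wrap_dist y (n y))) / 2 * (norm (a y - b (n y)))\<^sup>2
     + (U 0 - U (wrap_dist y (n y))) / 2 * (norm (a y + b (n y)))\<^sup>2)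
     = U 0 * (\<Sum>y\<in>P. (norm (a y))\<^sup>2) + U 0 * (\<Sum>y\<in>P. (norm (b (n y)))\<^sup>2) - 2 * sum X P"
    unfolding pair_form X_def by (simp add: sum_subtractf sum.distrib sum_distrib_left)
  ultimately show ?thesis by (simp add: distrib_left)
qed

lemma localizing_kernel:
  assumes "N \<ge> 1"
  obtains U w where "minorant_pair N U w" "localized N U"
proof (cases "N = 1")
  case True
  then show ?thesis using that dirichlet_minorant dirichlet_localized by blast
next
  case False
  then show ?thesis using that scaled_profile_minorant[of N] scaled_profile_localized[of N] assms by simp
qed

theorem corollary5p1:
  fixes N :: nat and q c_min :: real and f g :: "real \<Rightarrow> complex"
  assumes "N \<ge> 1"
    and "q \<ge> 3 / (2 * real N + 2)"
    and "f \<in> exp_sums_sep (2 * q)" and "g \<in> exp_sums_sep (2 * q)"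
    and "c_min > 0"
    and "\<forall>y\<in>freqs f. norm (coeffs_of f y) \<ge> c_min"
    and "\<forall>y\<in>freqs g. norm (coeffs_of g y) \<ge> c_min"
    and "(\<Sum>k = - int N..int N. (norm (f (of_int k) - g (of_int k)))\<^sup>2)
           < (4 * real N + 4) / 3 * c_min\<^sup>2"
  shows "(\<forall>y\<in>freqs f. \<exists>!z. z \<in> freqs g \<and> wrap_dist y z < 3 / (2 * real N + 2)) \<and>
    (\<forall>n. (\<forall>y\<in>freqs f. n y \<in> freqs g \<and> wrap_dist y (n y) < 3 / (2 * real N + 2)) \<longrightarrow>
      (\<Sum>y\<in>freqs f.
          (real N + 1) / 3 * (norm (coeffs_of f y - coeffs_of g (n y)))\<^sup>2
          + 2 * pi\<^sup>2 * (real N + 1) ^ 3 / 3 ^ 5 * (wrap_dist y (n y))\<^sup>2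
              * (norm (coeffs_of f y + coeffs_of g (n y)))\<^sup>2)
      \<le> (\<Sum>k = - int N..int N. (norm (f (of_int k) - g (of_int k)))\<^sup>2))"
proof -
  define F where "F = freqs f"
  define G where "G = freqs g"
  define a where "a = coeffs_of f"
  define b where "b = coeffs_of g"
  define \<rho> where "\<rho> = 3 / (2 * real N + 2)"
  define E where "E = (\<Sum>k = - int N..int N. (norm (f (of_int k) - g (of_int k)))\<^sup>2)"
  have \<rho>: "\<rho> > 0" "\<rho> \<le> q" using assms(2) by (auto simp: \<rho>_def)
  note fD = exp_sums_sepD[OF assms(3), folded F_def a_def]
  note gD = exp_sums_sepD[OF assms(4), folded G_def b_def]
  have sepF: "wrap_dist y y' \<ge> 2 * \<rho>" if "y \<in> F" "y' \<in> F" "y \<noteq> y'" for y y'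
    using fD(3)[OF that] \<rho> by linarith
  have sepG: "wrap_dist y y' \<ge> 2 * \<rho>" if "y \<in> G" "y' \<in> G" "y \<noteq> y'" for y y'
    using gD(3)[OF that] \<rho> by linarith
  obtain U w where Uw: "minorant_pair N U w" and loc: "localized N U"
    using localizing_kernel[OF assms(1)] .
  have U0: "U 0 \<ge> (4 * real N + 4) / 3" using loc by (simp add: localized_def)
  have Ufar: "U r = 0" if "r \<in> {0..1/2}" "r \<ge> \<rho>" for r
    using loc that by (auto simp: localized_def \<rho>_def)
  have Upair: "(real N + 1) / 3 * s + 2 * pi\<^sup>2 * (real N + 1) ^ 3 / 3 ^ 5 * (wrap_dist y z)\<^sup>2 * t
     \<le> (U 0 + U (wrap_dist y z)) / 2 * s + (U 0 - U (wrap_dist y z)) / 2 * t"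
    if "wrap_dist y z < \<rho>" "s \<ge> 0" "t \<ge> 0" for y z s t
  proof -
    have "wrap_dist y z \<in> {0..1/2}" using wrap_dist_nonneg wrap_dist_le_half by simp
    then have "(U 0 + U (wrap_dist y z)) / 2 \<ge> (real N + 1) / 3"
      "(U 0 - U (wrap_dist y z)) / 2 \<ge> 2 * pi\<^sup>2 * (real N + 1) ^ 3 / 3 ^ 5 * (wrap_dist y z)\<^sup>2"
      using loc that(1) unfolding localized_def \<rho>_def by blast+
    then show ?thesis using that by (intro add_mono mult_right_mono)
  qed
  define d where "d = case_sum a (\<lambda>z. - b z)"
  have energy: "(\<Sum>i\<in>F <+> G. \<Sum>j\<in>F <+> G. Re (d i * cnj (d j))
         * U (wrap_dist (case_sum id id i) (case_sum id id j))) \<le> E"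
  proof -
    have "f m - g m = (\<Sum>i\<in>F <+> G. d i * cis (2 * pi * m * case_sum id id i))" for m
      using fD gD by (simp add: sum.Plus d_def o_def sum_negf)
    moreover have "(\<Sum>i\<in>F <+> G. \<Sum>j\<in>F <+> G. Re (d i * cnj (d j))
         * U (wrap_dist (case_sum id id i) (case_sum id id j)))
       \<le> (\<Sum>m=-int N..int N. (norm (\<Sum>i\<in>F <+> G. d i * cis (2 * pi * m * case_sum id id i)))\<^sup>2)"
      using Uw unfolding minorant_pair_def by (intro minorant_energy_le[of U w]) auto
    ultimately show ?thesis by (simp add: E_def)
  qed
  have lower: "U 0 * (\<Sum>y\<in>F - P. (norm (a y))\<^sup>2) + (\<Sum>y\<in>P. (real N + 1) / 3 * (norm (a y - b (n y)))\<^sup>2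
          + 2 * pi\<^sup>2 * (real N + 1) ^ 3 / 3 ^ 5 * (wrap_dist y (n y))\<^sup>2 * (norm (a y + b (n y)))\<^sup>2) \<le> E"
    if "P \<subseteq> F" "\<And>y. y \<in> P \<Longrightarrow> n y \<in> G \<and> wrap_dist y (n y) < \<rho>"
      "\<And>y z. y \<in> F - P \<Longrightarrow> z \<in> G \<Longrightarrow> wrap_dist y z \<ge> \<rho>" for P n
  proof -
    have "U 0 * (\<Sum>y\<in>F - P. (norm (a y))\<^sup>2) + (\<Sum>y\<in>P.
       (U 0 + U (wrap_dist y (n y))) / 2 * (norm (a y - b (n y)))\<^sup>2
     + (U 0 - U (wrap_dist y (n y))) / 2 * (norm (a y + b (n y)))\<^sup>2) \<le> E"
      using matched_energy_le[of F G \<rho> U P n a b, OF fD(1) gD(1) sepF sepG \<rho>(1) Ufar _ that] U0 energy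
      unfolding d_def by simp
    moreover have "(\<Sum>y\<in>P. (real N + 1) / 3 * (norm (a y - b (n y)))\<^sup>2
          + 2 * pi\<^sup>2 * (real N + 1) ^ 3 / 3 ^ 5 * (wrap_dist y (n y))\<^sup>2 * (norm (a y + b (n y)))\<^sup>2)
       \<le> (\<Sum>y\<in>P. (U 0 + U (wrap_dist y (n y))) / 2 * (norm (a y - b (n y)))\<^sup>2
     + (U 0 - U (wrap_dist y (n y))) / 2 * (norm (a y + b (n y)))\<^sup>2)"
      using that(2) by (intro sum_mono Upair) auto
    ultimately show ?thesis by linarith
  qed
  (* an unmatched frequency alone would contribute at least U 0 * c_min^2, and pairs are nonnegative *)
  have matched: "\<exists>z\<in>G. wrap_dist y z < \<rho>" if y: "y \<in> F" for y
  proof (rule ccontr)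
    assume neg: "\<not> (\<exists>z\<in>G. wrap_dist y z < \<rho>)"
    define P where "P = {y\<in>F. \<exists>z\<in>G. wrap_dist y z < \<rho>}"
    have "\<forall>y\<in>P. \<exists>z. z \<in> G \<and> wrap_dist y z < \<rho>" by (auto simp: P_def)
    from bchoice[OF this] obtain n where n: "\<forall>y\<in>P. n y \<in> G \<and> wrap_dist y (n y) < \<rho>" by blast
    have "U 0 * (\<Sum>y\<in>F - P. (norm (a y))\<^sup>2) + (\<Sum>y\<in>P. (real N + 1) / 3 * (norm (a y - b (n y)))\<^sup>2
          + 2 * pi\<^sup>2 * (real N + 1) ^ 3 / 3 ^ 5 * (wrap_dist y (n y))\<^sup>2 * (norm (a y + b (n y)))\<^sup>2) \<le> E"
    proof (rule lower)
      show "P \<subseteq> F" by (auto simp: P_def)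
      show "n y \<in> G \<and> wrap_dist y (n y) < \<rho>" if "y \<in> P" for y using n that by blast
      show "\<rho> \<le> wrap_dist y z" if "y \<in> F - P" "z \<in> G" for y z using that by (force simp: P_def)
    qed
    moreover have "(\<Sum>y\<in>P. (real N + 1) / 3 * (norm (a y - b (n y)))\<^sup>2
          + 2 * pi\<^sup>2 * (real N + 1) ^ 3 / 3 ^ 5 * (wrap_dist y (n y))\<^sup>2 * (norm (a y + b (n y)))\<^sup>2) \<ge> 0"
      by (intro sum_nonneg add_nonneg_nonneg mult_nonneg_nonneg divide_nonneg_nonneg) auto
    moreover have "(4 * real N + 4) / 3 * c_min\<^sup>2 \<le> U 0 * (\<Sum>y\<in>F - P. (norm (a y))\<^sup>2)"
    proof (intro mult_mono U0)
      have "c_min\<^sup>2 \<le> (norm (a y))\<^sup>2"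
        using assms(5,6) y by (intro power_mono) (auto simp: F_def a_def)
      also have "\<dots> \<le> (\<Sum>y\<in>F - P. (norm (a y))\<^sup>2)"
        using y neg fD(1) by (intro member_le_sum) (auto simp: P_def)
      finally show "c_min\<^sup>2 \<le> (\<Sum>y\<in>F - P. (norm (a y))\<^sup>2)" .
    qed (use U0 in auto)
    ultimately show False using assms(8) unfolding E_def[symmetric] by linarith
  qed
  have unique: "\<exists>!z. z \<in> G \<and> wrap_dist y z < \<rho>" if y: "y \<in> F" for y
  proof -
    obtain z where z: "z \<in> G" "wrap_dist y z < \<rho>" using matched[OF y] by blast
    moreover have "z' = z" if "z' \<in> G" "wrap_dist y z' < \<rho>" for z'
      using sepG[of z' z] wrap_dist_triangle[of z' z y] wrap_dist_commute[of y z'] z that by linarith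
    ultimately show ?thesis by blast
  qed
  have estimate: "(\<Sum>y\<in>F. (real N + 1) / 3 * (norm (a y - b (n y)))\<^sup>2
          + 2 * pi\<^sup>2 * (real N + 1) ^ 3 / 3 ^ 5 * (wrap_dist y (n y))\<^sup>2 * (norm (a y + b (n y)))\<^sup>2) \<le> E"
    if "\<forall>y\<in>F. n y \<in> G \<and> wrap_dist y (n y) < \<rho>" for n
    using lower[of F n] that by simp
  show ?thesis
    unfolding F_def[symmetric] G_def[symmetric] a_def[symmetric] b_def[symmetric]
      \<rho>_def[symmetric] E_def[symmetric]
    by (intro conjI ballI allI impI unique estimate) auto
qed

end
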